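(* Let $M$ be a fixed $f$-implicit $\alpha$-Fréchet sup-measure with control measure $m$, with associated integral $I$, and let $g,g_1,g_2,\dots\in L^\alpha_+(m)$. Then, as $n\to\infty$, $$I(g_n)\overset{\mathbb{P}}{\longrightarrow}I(g)\quad\Longleftrightarrow\quad\int_E|g_n^\alpha-g^\alpha|\,dm\to0\quad\Longleftrightarrow\quad\int_E|g_n-g|^\alpha\,dm\to0,$$ where $\overset{\mathbb{P}}{\longrightarrow}$ denotes convergence in probability.
   Context: Loss function. Let $d\ge 1$ and let $f:\mathbb{R}^d\to[0,\infty)$ be fixed such that $f$ is continuous; $f(x)=0$ if and only if $x=0$; and $f(\lambda x)=\lambda f(x)$ for all $\lambda\ge 0$, $x\in\mathbb{R}^d$. Put $S=\{x\in\mathbb{R}^d: f(x)=1\}$ (a compact set). For $x_1,x_2\in\mathbb{R}^d$ let $x_1\vee_f x_2=x_1$ if $f(x_2)\le f(x_1)$ and $x_1\vee_f x_2=x_2$ if $f(x_1)<f(x_2)$. This operation is associative, and inductively $x_1\vee_f\cdots\vee_f x_k=(x_1\vee_f\cdots\vee_f x_{k-1})\vee_f x_k$. Fréchet laws. Fix $\alpha>0$. For $\sigma\ge0$, $\Phi_\alpha(\sigma)$ is the law of a real random variable $Z$ with $\mathbb{P}(Z\le x)=\exp(-\sigma^\alpha x^{-\alpha})$ for $x>0$ and $\mathbb{P}(Z\le x)=0$ for $x<0$ (so $\Phi_\alpha(0)$ is the point mass at $0$, and $\mathbb{P}(Z\le 0)=0$ if $\sigma>0$). Fix a probability measure $\kappa$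 on $\mathcal{B}(S)$. An $\mathbb{R}^d$-valued random vector $Y$ has law $\Phi^f_{\alpha,\kappa}(\sigma)$ ($f$-implicit $\alpha$-Fréchet with scale $\sigma\ge 0$ and angular part $\kappa$) if $Y\overset{d}{=}\sigma Z\Theta$ with $Z\sim\Phi_\alpha(1)$ independent of the $S$-valued random vector $\Theta\sim\kappa$. Sup-measure. Let $(E,\mathcal{E},m)$ be a $\sigma$-finite measure space, $\mathcal{E}_0=\{A\in\mathcal{E}:m(A)<\infty\}$. On a probability space $(\Omega,\mathcal{A},\mathbb{P})$, $M$ is a map from $\mathcal{E}_0$ to the $\mathbb{R}^d$-valued random vectors such that: ($RM_1$) $M(A_1),\dots,M(A_k)$ are independent for finitely many disjoint $A_1,\dots,A_k\in\mathcal{E}_0$; ($RM_2$) for disjoint $A_1,A_2,\dots\in\mathcal{E}_0$ with $\bigcup_j A_j\in\mathcal{E}_0$, almost surely $M(\bigcup_j A_j)=\lim_{k\to\infty} M(A_1)\vee_f\cdots\vee_f M(A_k)=M(A_{j_0})$ for some random index $j_0$; and $M(A)\sim\Phi^f_{\alpha,\kappa}(m(A)^{1/\alpha})$ for every $A\in\mathcal{E}_0$. Integral. A function $g:E\to[0,\infty)$ is simple if $g=\sum_{j=1}^k\alpha_j\mathbf{1}_{A_j}$ with $k\in\mathbb{N}$, $\alpha_j\ge0$ and disjoint $A_j\in\mathcal{E}_0$; then $I(g):=\alpha_1M(A_1)\vee_f\cdots\vee_f\alpha_kM(A_k)$, which a.s. does not depend on the chosen representation. $L^\alpha_+(m)$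 is the set of measurable $g:E\to[0,\infty)$ with $\|g\|_\alpha:=(\int_E g^\alpha\,dm)^{1/\alpha}<\infty$. For $g\in L^\alpha_+(m)$, $I(g)$ is the limit in probability of $I(g_n)$ for any sequence of simple functions $(g_n)$ increasing pointwise to $g$ on $E$; this limit exists and is a.s. independent of the sequence $(g_n)$. *)

theory Defs
  imports "HOL-Probability.Probability"
begin

section \<open>The loss function and the induced maximum operation\<close>

locale loss_function =
  fixes f :: "real ^ 'd \<Rightarrow> real"
  assumes continuous: "continuous_on UNIV f"
    and nonneg: "0 \<le> f x"
    and eq_0_iff: "f x = 0 \<longleftrightarrow> x = 0"
    and homogeneous: "0 \<le> c \<Longrightarrow> f (c *\<^sub>R x) = c * f x"

definition f_max :: "('v \<Rightarrow> real) \<Rightarrow> 'v \<Rightarrow> 'v \<Rightarrow> 'v" where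
  "f_max f x y = (if f y \<le> f x then x else y)"

text \<open>Indices start at 0: \<open>f_Max f x n\<close> is the left-associated maximum of the \<open>n + 1\<close> vectors
  \<open>x 0, \<dots>, x n\<close>.\<close>

primrec f_Max :: "('v \<Rightarrow> real) \<Rightarrow> (nat \<Rightarrow> 'v) \<Rightarrow> nat \<Rightarrow> 'v" where
  "f_Max f x 0 = x 0"
| "f_Max f x (Suc n) = f_max f (f_Max f x n) (x (Suc n))"

section \<open>Frechet laws\<close>

text \<open>For \<open>\<sigma> = 0\<close> the formula for \<open>x > 0\<close> reads \<open>exp 0 = 1\<close>, since \<open>0 powr \<alpha> = 0\<close>; this is
  the point mass at 0.\<close>

definition frechet_law :: "real \<Rightarrow> real \<Rightarrow> real measure \<Rightarrow> bool" where
  "frechet_law \<alpha> \<sigma> N \<longleftrightarrow> real_distribution N \<and>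
     (\<forall>x>0. cdf N x = exp (- (\<sigma> powr \<alpha> * x powr (- \<alpha>)))) \<and>
     (\<forall>x<0. cdf N x = 0)"

text \<open>\<open>Y\<close> is equal in distribution to \<open>\<sigma> Z \<Theta>\<close>, where independence of \<open>Z\<close> and \<open>\<Theta>\<close> is expressed
  by the pair \<open>(Z, \<Theta>)\<close> having the product law \<open>N \<Otimes>\<^sub>M \<kappa>\<close>.\<close>

definition has_implicit_frechet_law ::
  "'w measure \<Rightarrow> real \<Rightarrow> (real ^ 'd) measure \<Rightarrow> real \<Rightarrow> ('w \<Rightarrow> real ^ 'd) \<Rightarrow> bool" where
  "has_implicit_frechet_law P \<alpha> \<kappa> \<sigma> Y \<longleftrightarrow> Y \<in> borel_measurable P \<and>
     (\<exists>N. frechet_law \<alpha> 1 N \<and>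
        distr P borel Y = distr (N \<Otimes>\<^sub>M \<kappa>) borel (\<lambda>(z, \<theta>). (\<sigma> * z) *\<^sub>R \<theta>))"

section \<open>Sup-measures\<close>

locale implicit_frechet_sup_measure =
  loss_function f + m: sigma_finite_measure m + P: prob_space P + \<kappa>: prob_space \<kappa>
  for f :: "real ^ 'd \<Rightarrow> real"
    and \<alpha> :: real
    and \<kappa> :: "(real ^ 'd) measure"
    and m :: "'e measure"
    and P :: "'w measure"
    and M :: "'e set \<Rightarrow> 'w \<Rightarrow> real ^ 'd" +
  assumes alpha_pos: "0 < \<alpha>"
    and sets_kappa: "sets \<kappa> = sets (restrict_space borel {x. f x = 1})"
    and random_vector: "A \<in> fmeasurable m \<Longrightarrow> M A \<in> borel_measurable P"
    and RM1: "(\<And>i. i < k \<Longrightarrow> B i \<in> fmeasurable m) \<Longrightarrow> disjoint_family_on B {..<k::nat} \<Longrightarrow>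
        prob_space.indep_vars P (\<lambda>_. borel) (\<lambda>i. M (B i)) {..<k}"
    and RM2: "(\<And>j::nat. B j \<in> fmeasurable m) \<Longrightarrow> disjoint_family B \<Longrightarrow>
        (\<Union>j. B j) \<in> fmeasurable m \<Longrightarrow>
        \<exists>J \<in> measurable P (count_space UNIV). AE \<omega> in P.
          (\<lambda>k. f_Max f (\<lambda>j. M (B j) \<omega>) k) \<longlonglongrightarrow> M (\<Union>j. B j) \<omega> \<and>
          M (\<Union>j. B j) \<omega> = M (B (J \<omega>)) \<omega>"
    and law: "A \<in> fmeasurable m \<Longrightarrow>
        has_implicit_frechet_law P \<alpha> \<kappa> (measure m A powr (1 / \<alpha>)) (M A)"

section \<open>The integral\<close>

definition tendsto_in_prob ::
  "'w measure \<Rightarrow> (nat \<Rightarrow> 'w \<Rightarrow> 'v::metric_space) \<Rightarrow> ('w \<Rightarrow> 'v) \<Rightarrow> bool" where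
  "tendsto_in_prob P X Y \<longleftrightarrow>
     (\<forall>\<epsilon>>0. (\<lambda>n. measure P {\<omega> \<in> space P. \<epsilon> < dist (X n \<omega>) (Y \<omega>)}) \<longlonglongrightarrow> 0)"

text \<open>The function \<open>g\<close> equals \<open>a 0 \<cdot> 1\<^bsub>B 0\<^esub> + \<dots> + a n \<cdot> 1\<^bsub>B n\<^esub>\<close> on the underlying space.\<close>

definition simple_repr ::
  "'e measure \<Rightarrow> ('e \<Rightarrow> real) \<Rightarrow> nat \<Rightarrow> (nat \<Rightarrow> real) \<Rightarrow> (nat \<Rightarrow> 'e set) \<Rightarrow> bool" where
  "simple_repr m g n a B \<longleftrightarrow>
     (\<forall>j\<le>n. 0 \<le> a j \<and> B j \<in> fmeasurable m) \<and> disjoint_family_on B {..n} \<and>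
     (\<forall>x\<in>space m. g x = (\<Sum>j\<le>n. a j * indicator (B j) x))"

text \<open>\<open>Y\<close> is the integral of the simple function \<open>g\<close>, computed from one of its representations.
  Integrals computed from different representations are almost surely equal.\<close>

definition is_simple_integral ::
  "(real ^ 'd \<Rightarrow> real) \<Rightarrow> 'e measure \<Rightarrow> ('e set \<Rightarrow> 'w \<Rightarrow> real ^ 'd) \<Rightarrow>
    ('e \<Rightarrow> real) \<Rightarrow> ('w \<Rightarrow> real ^ 'd) \<Rightarrow> bool" where
  "is_simple_integral f m M g Y \<longleftrightarrow>
     (\<exists>n a B. simple_repr m g n a B \<and> Y = (\<lambda>\<omega>. f_Max f (\<lambda>j. a j *\<^sub>R M (B j) \<omega>) n))"

definition Lp_plus :: "'e measure \<Rightarrow> real \<Rightarrow> ('e \<Rightarrow> real) set" where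
  "Lp_plus m \<alpha> = {g \<in> borel_measurable m. (\<forall>x\<in>space m. 0 \<le> g x) \<and>
     (\<integral>\<^sup>+x. ennreal (g x powr \<alpha>) \<partial>m) < \<infinity>}"

text \<open>The integral is determined up to almost sure equality; a version is chosen. It has to be the
  limit in probability along every sequence of simple functions increasing to \<open>g\<close>, whichever
  representations are used for the integrals of these simple functions.\<close>

definition implicit_integral ::
  "(real ^ 'd \<Rightarrow> real) \<Rightarrow> 'e measure \<Rightarrow> 'w measure \<Rightarrow> ('e set \<Rightarrow> 'w \<Rightarrow> real ^ 'd) \<Rightarrow>
    ('e \<Rightarrow> real) \<Rightarrow> 'w \<Rightarrow> real ^ 'd" where
  "implicit_integral f m P M g = (SOME X. X \<in> borel_measurable P \<and>
     (\<forall>h Y. (\<forall>n. is_simple_integral f m M (h n) (Y n)) \<longrightarrow>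
        (\<forall>x\<in>space m. incseq (\<lambda>n. h n x) \<and> (\<lambda>n. h n x) \<longlonglongrightarrow> g x) \<longrightarrow>
        tendsto_in_prob P Y X))"

end

theory Submission
  imports Defs
begin

text \<open>Two estimates carry the proof; both are first obtained for simple functions and then passed to the
limit.

For simple functions \<open>g\<close> and \<open>h\<close>, written over one common family of disjoint sets, the event
\<open>f (I g) \<le> x \<and> f (I h) \<le> x\<close> says that finitely many independent Frechet variables stay below
thresholds, so its probability is \<open>exp (- x powr - \<alpha> * \<integral> max (g powr \<alpha>) (h powr \<alpha>))\<close>
(\<open>simple_integral_joint_law\<close>). The formula survives limits in probability
(\<open>integral_version_joint_law\<close>). If \<open>I (gs n)\<close> tends to \<open>I g\<close> in probability, then the formula at
\<open>x = 1\<close>, used for \<open>gs n\<close> alone and for the pair \<open>gs n\<close>, \<open>g\<close>, shows that both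
\<open>\<integral> gs n powr \<alpha>\<close> and \<open>\<integral> max (gs n powr \<alpha>) (g powr \<alpha>)\<close> tend to \<open>\<integral> g powr \<alpha>\<close>. Since
\<open>\<bar>a - b\<bar> = 2 * max a b - a - b\<close>, this is convergence of \<open>gs n powr \<alpha>\<close> to \<open>g powr \<alpha>\<close> in \<open>L1\<close>
(\<open>tendsto_in_prob_imp_powr_dist_tendsto\<close>).

For the converse the values of \<open>f\<close> do not suffice, because \<open>I g\<close> and \<open>I h\<close> could point in different
directions although their losses are close. Fix a fine finite grid of levels. If no level separates
\<open>f (I g)\<close> from \<open>f (I h)\<close>, both losses lie in the same cell of the grid. If the two maxima were
attained at different sets of the common family, two independent variables would fall into that one
cell, which is unlikely for a fine grid: the probability is quadratic in the size of the cell and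
only linearly many cells occur. If they are attained at the same set, the two vectors are multiples
of one vector and their distance is comparable to the difference of the losses. A level is a
separating one with probability controlled by \<open>\<integral> \<bar>g powr \<alpha> - h powr \<alpha>\<bar>\<close>. This gives a bound on the
distance in probability that depends on \<open>g\<close> and \<open>h\<close> only through their norms and that integral
(\<open>prob_dist_f_max_le\<close>, \<open>simple_integral_dist_uniform\<close>). It implies at once that the integral exists
(\<open>implicit_integral_version\<close>), since the integrals of an increasing sequence of simple functions
are Cauchy in probability, and that the integral is continuous
(\<open>integral_version_tendsto_in_prob\<close>).

The equivalence of the two analytic conditions is a pointwise matter: up to a small multiple of
\<open>b powr \<alpha>\<close>, each of \<open>\<bar>a powr \<alpha> - b powr \<alpha>\<bar>\<close> and \<open>\<bar>a - b\<bar> powr \<alpha>\<close> is bounded by a multiple of the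
other (\<open>powr_L1_iff_Lp\<close>).\<close>

section \<open>Comparing powers of differences with differences of powers\<close>

text \<open>Near \<open>1\<close> the left side is at most \<open>\<epsilon>\<close> by continuity; away from \<open>1\<close> both \<open>a\<close> and \<open>1\<close> are at most a
constant times \<open>\<bar>a - 1\<bar>\<close>.\<close>

lemma abs_powr_diff_one_le:
  fixes \<alpha> \<epsilon> :: real
  assumes "0 < \<alpha>" "0 < \<epsilon>"
  obtains C where "0 \<le> C" "\<And>a. 0 \<le> a \<Longrightarrow> \<bar>a powr \<alpha> - 1\<bar> \<le> \<epsilon> + C * \<bar>a - 1\<bar> powr \<alpha>"
proof -
  have "((\<lambda>a. a powr \<alpha>) \<longlongrightarrow> 1 powr \<alpha>) (at (1::real))"
    by (intro tendsto_intros) auto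
  then have "\<forall>\<^sub>F a in at (1::real). dist (a powr \<alpha>) 1 < \<epsilon>"
    using assms(2) by (auto dest!: tendstoD)
  then obtain \<eta> where \<eta>: "0 < \<eta>" "\<And>a. a \<noteq> 1 \<Longrightarrow> \<bar>a - 1\<bar> < \<eta> \<Longrightarrow> \<bar>a powr \<alpha> - 1\<bar> < \<epsilon>"
    unfolding eventually_at dist_real_def by auto
  define C where "C = (1 / \<eta> + 1) powr \<alpha> + (1 / \<eta>) powr \<alpha>"
  show thesis
  proof
    show "0 \<le> C" by (simp add: C_def)
    fix a :: real assume a: "0 \<le> a"
    show "\<bar>a powr \<alpha> - 1\<bar> \<le> \<epsilon> + C * \<bar>a - 1\<bar> powr \<alpha>"
    proof (cases "\<bar>a - 1\<bar> < \<eta>")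
      case True
      then have "\<bar>a powr \<alpha> - 1\<bar> \<le> \<epsilon>" using \<eta>(2)[of a] assms by (cases "a = 1") auto
      then show ?thesis using \<open>0 \<le> C\<close> by (smt (verit) mult_nonneg_nonneg powr_ge_zero)
    next
      case False
      then have *: "1 \<le> \<bar>a - 1\<bar> * (1 / \<eta>)" using \<eta>(1) by (simp add: field_simps)
      have "a \<le> (1 / \<eta> + 1) * \<bar>a - 1\<bar>" using * by (simp add: algebra_simps)
      then have "a powr \<alpha> \<le> ((1 / \<eta> + 1) * \<bar>a - 1\<bar>) powr \<alpha>" using a assms by (intro powr_mono2) auto
      moreover have "1 powr \<alpha> \<le> ((1 / \<eta>) * \<bar>a - 1\<bar>) powr \<alpha>"
        using * assms by (intro powr_mono2) (auto simp: mult.commute)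
      ultimately have "a powr \<alpha> + 1 \<le> C * \<bar>a - 1\<bar> powr \<alpha>"
        unfolding C_def distrib_right powr_mult[symmetric] by simp
      then show ?thesis using assms by (smt (verit) powr_ge_zero)
    qed
  qed
qed

text \<open>By homogeneity this reduces to the case \<open>b = 1\<close>.\<close>

lemma abs_powr_diff_le:
  fixes \<alpha> \<epsilon> :: real
  assumes "0 < \<alpha>" "0 < \<epsilon>"
  obtains C where "0 \<le> C"
    "\<And>a b. 0 \<le> a \<Longrightarrow> 0 \<le> b \<Longrightarrow> \<bar>a powr \<alpha> - b powr \<alpha>\<bar> \<le> \<epsilon> * b powr \<alpha> + C * \<bar>a - b\<bar> powr \<alpha>"
proof -
  obtain C where C: "0 \<le> C" "\<And>a. 0 \<le> a \<Longrightarrow> \<bar>a powr \<alpha> - 1\<bar> \<le> \<epsilon> + C * \<bar>a - 1\<bar> powr \<alpha>"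
    using abs_powr_diff_one_le[OF assms] by blast
  show thesis
  proof
    show "0 \<le> max 1 C" by simp
    fix a b :: real assume ab: "0 \<le> a" "0 \<le> b"
    show "\<bar>a powr \<alpha> - b powr \<alpha>\<bar> \<le> \<epsilon> * b powr \<alpha> + max 1 C * \<bar>a - b\<bar> powr \<alpha>"
    proof (cases "b = 0")
      case True
      then show ?thesis using ab mult_right_mono[of 1 "max 1 C" "a powr \<alpha>"] by simp
    next
      case False
      then have b: "0 < b" using ab by simp
      have "\<bar>(a / b) powr \<alpha> - 1\<bar> \<le> \<epsilon> + C * \<bar>a / b - 1\<bar> powr \<alpha>" using C(2)[of "a / b"] ab by simp
      also have "C * \<bar>a / b - 1\<bar> powr \<alpha> \<le> max 1 C * \<bar>a / b - 1\<bar> powr \<alpha>" by (intro mult_right_mono) auto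
      finally have "b powr \<alpha> * \<bar>(a / b) powr \<alpha> - 1\<bar> \<le> b powr \<alpha> * (\<epsilon> + max 1 C * \<bar>a / b - 1\<bar> powr \<alpha>)"
        by (intro mult_left_mono) auto
      moreover have "b powr \<alpha> * \<bar>(a / b) powr \<alpha> - 1\<bar> = \<bar>a powr \<alpha> - b powr \<alpha>\<bar>"
      proof -
        have "b powr \<alpha> * \<bar>(a / b) powr \<alpha> - 1\<bar> = \<bar>b powr \<alpha> * ((a / b) powr \<alpha> - 1)\<bar>"
          by (simp add: abs_mult)
        also have "b powr \<alpha> * ((a / b) powr \<alpha> - 1) = a powr \<alpha> - b powr \<alpha>"
          using ab b by (simp add: powr_divide field_simps)
        finally show ?thesis .
      qed
      moreover have "b powr \<alpha> * \<bar>a / b - 1\<bar> powr \<alpha> = \<bar>a - b\<bar> powr \<alpha>"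
      proof -
        have "b powr \<alpha> * \<bar>a / b - 1\<bar> powr \<alpha> = (b * \<bar>a / b - 1\<bar>) powr \<alpha>" using b by (simp add: powr_mult)
        also have "b * \<bar>a / b - 1\<bar> = \<bar>b * (a / b - 1)\<bar>" using b by (simp add: abs_mult)
        also have "b * (a / b - 1) = a - b" using b by (simp add: field_simps)
        finally show ?thesis .
      qed
      ultimately show ?thesis by (simp add: algebra_simps)
    qed
  qed
qed

lemma powr_add_le:
  fixes x y \<alpha> :: real
  assumes "0 < \<alpha>" "0 \<le> x" "0 \<le> y"
  shows "(x + y) powr \<alpha> \<le> 2 powr \<alpha> * (x powr \<alpha> + y powr \<alpha>)"
proof -
  have "(x + y) powr \<alpha> \<le> (2 * max x y) powr \<alpha>" using assms by (intro powr_mono2) auto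
  also have "\<dots> = 2 powr \<alpha> * (max x y) powr \<alpha>" using assms by (simp add: powr_mult)
  also have "(max x y) powr \<alpha> \<le> x powr \<alpha> + y powr \<alpha>" by (simp add: max_def)
  finally show ?thesis by (simp add: mult_left_mono)
qed

text \<open>The previous inequality for the exponent \<open>1 / \<alpha>\<close>, applied to \<open>a powr \<alpha>\<close> and \<open>b powr \<alpha>\<close> and raised to
the power \<open>\<alpha>\<close>.\<close>

lemma abs_diff_powr_le:
  fixes \<alpha> \<epsilon> :: real
  assumes "0 < \<alpha>" "0 < \<epsilon>"
  obtains C where "0 \<le> C"
    "\<And>a b. 0 \<le> a \<Longrightarrow> 0 \<le> b \<Longrightarrow> \<bar>a - b\<bar> powr \<alpha> \<le> \<epsilon> * b powr \<alpha> + C * \<bar>a powr \<alpha> - b powr \<alpha>\<bar>"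
proof -
  define \<eta> where "\<eta> = (\<epsilon> / 2 powr \<alpha>) powr (1 / \<alpha>)"
  have \<eta>: "0 < \<eta>" "2 powr \<alpha> * \<eta> powr \<alpha> = \<epsilon>" using assms by (auto simp: \<eta>_def powr_powr)
  obtain C where C: "0 \<le> C" "\<And>p q. 0 \<le> p \<Longrightarrow> 0 \<le> q \<Longrightarrow>
      \<bar>p powr (1/\<alpha>) - q powr (1/\<alpha>)\<bar> \<le> \<eta> * q powr (1/\<alpha>) + C * \<bar>p - q\<bar> powr (1/\<alpha>)"
    using abs_powr_diff_le[of "1/\<alpha>" \<eta>] assms \<eta> by auto
  show thesis
  proof
    show "0 \<le> 2 powr \<alpha> * C powr \<alpha>" by simp
    fix a b :: real assume ab: "0 \<le> a" "0 \<le> b"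
    let ?d = "\<bar>a powr \<alpha> - b powr \<alpha>\<bar>"
    have "\<bar>a - b\<bar> \<le> \<eta> * b + C * ?d powr (1/\<alpha>)"
      using C(2)[of "a powr \<alpha>" "b powr \<alpha>"] ab assms by (simp add: powr_powr)
    then have "\<bar>a - b\<bar> powr \<alpha> \<le> (\<eta> * b + C * ?d powr (1/\<alpha>)) powr \<alpha>"
      using assms by (intro powr_mono2) auto
    also have "\<dots> \<le> 2 powr \<alpha> * ((\<eta> * b) powr \<alpha> + (C * ?d powr (1/\<alpha>)) powr \<alpha>)"
      using assms \<eta> C ab by (intro powr_add_le) auto
    also have "\<dots> = 2 powr \<alpha> * \<eta> powr \<alpha> * b powr \<alpha> + 2 powr \<alpha> * C powr \<alpha> * ?d"
      using assms \<eta> C ab by (simp add: powr_mult powr_powr algebra_simps)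
    finally show "\<bar>a - b\<bar> powr \<alpha> \<le> \<epsilon> * b powr \<alpha> + 2 powr \<alpha> * C powr \<alpha> * ?d"
      using \<eta> by simp
  qed
qed

text \<open>Integrating the pointwise bound and letting \<open>n\<close> tend to infinity leaves \<open>\<epsilon>\<close> times the finite integral
of \<open>h\<close>, for every \<open>\<epsilon>\<close>.\<close>

lemma nn_integral_tendsto_0_comparison:
  fixes F G :: "nat \<Rightarrow> 'e \<Rightarrow> real" and h :: "'e \<Rightarrow> real"
  assumes G: "(\<lambda>n. \<integral>\<^sup>+x. ennreal (G n x) \<partial>m) \<longlonglongrightarrow> 0"
    and h: "(\<integral>\<^sup>+x. ennreal (h x) \<partial>m) < \<infinity>" "\<And>x. x \<in> space m \<Longrightarrow> 0 \<le> h x"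
    and meas: "h \<in> borel_measurable m" "\<And>n. G n \<in> borel_measurable m"
    and G0: "\<And>n x. x \<in> space m \<Longrightarrow> 0 \<le> G n x"
    and bound: "\<And>\<epsilon>. 0 < \<epsilon> \<Longrightarrow> \<exists>C\<ge>0. \<forall>n. \<forall>x\<in>space m. F n x \<le> \<epsilon> * h x + C * G n x"
  shows "(\<lambda>n. \<integral>\<^sup>+x. ennreal (F n x) \<partial>m) \<longlonglongrightarrow> 0"
proof (rule tendsto_0_if_Limsup_eq_0_ennreal)
  define c where "c = enn2real (\<integral>\<^sup>+x. ennreal (h x) \<partial>m)"
  have c: "(\<integral>\<^sup>+x. ennreal (h x) \<partial>m) = ennreal c" "0 \<le> c" using h by (auto simp: c_def)
  have "Limsup sequentially (\<lambda>n. \<integral>\<^sup>+x. ennreal (F n x) \<partial>m) \<le> 0 + ennreal e" if e: "0 < e" for e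
  proof -
    define \<epsilon> where "\<epsilon> = e / (c + 1)"
    have \<epsilon>: "0 < \<epsilon>" "\<epsilon> * c \<le> e" using e c by (auto simp: \<epsilon>_def field_simps)
    obtain C where C: "0 \<le> C" "\<And>n x. x \<in> space m \<Longrightarrow> F n x \<le> \<epsilon> * h x + C * G n x" using bound \<epsilon> by meson
    have le: "(\<integral>\<^sup>+x. ennreal (F n x) \<partial>m) \<le> ennreal e + ennreal C * (\<integral>\<^sup>+x. ennreal (G n x) \<partial>m)" for n
    proof -
      have "(\<integral>\<^sup>+x. ennreal (F n x) \<partial>m) \<le> (\<integral>\<^sup>+x. ennreal \<epsilon> * ennreal (h x) + ennreal C * ennreal (G n x) \<partial>m)"
      proof (rule nn_integral_mono)
        fix x assume x: "x \<in> space m"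
        then show "ennreal (F n x) \<le> ennreal \<epsilon> * ennreal (h x) + ennreal C * ennreal (G n x)"
          using C h(2)[OF x] G0[OF x] \<epsilon> by (simp add: ennreal_mult[symmetric] ennreal_plus[symmetric] del: ennreal_plus)
      qed
      also have "\<dots> = ennreal \<epsilon> * ennreal c + ennreal C * (\<integral>\<^sup>+x. ennreal (G n x) \<partial>m)"
        using meas by (subst nn_integral_add) (auto simp: nn_integral_cmult c)
      also have "ennreal \<epsilon> * ennreal c \<le> ennreal e"
        using \<epsilon> c by (simp add: ennreal_mult[symmetric] ennreal_leI)
      finally show ?thesis by (simp add: add_right_mono)
    qed
    have "(\<lambda>n. ennreal e + ennreal C * (\<integral>\<^sup>+x. ennreal (G n x) \<partial>m)) \<longlonglongrightarrow> ennreal e + ennreal C * 0"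
      by (intro tendsto_add tendsto_const ennreal_tendsto_cmult G) auto
    then have "Limsup sequentially (\<lambda>n. ennreal e + ennreal C * (\<integral>\<^sup>+x. ennreal (G n x) \<partial>m)) = ennreal e"
      by (intro lim_imp_Limsup) auto
    then show ?thesis using Limsup_mono[of "\<lambda>n. \<integral>\<^sup>+x. ennreal (F n x) \<partial>m"
          "\<lambda>n. ennreal e + ennreal C * (\<integral>\<^sup>+x. ennreal (G n x) \<partial>m)" sequentially] le by auto
  qed
  then have "Limsup sequentially (\<lambda>n. \<integral>\<^sup>+x. ennreal (F n x) \<partial>m) \<le> 0"
    by (rule ennreal_le_epsilon) auto
  then show "Limsup sequentially (\<lambda>n. \<integral>\<^sup>+x. ennreal (F n x) \<partial>m) = 0" by simp
qed

lemma powr_L1_iff_Lp: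
  fixes g :: "'e \<Rightarrow> real" and gs :: "nat \<Rightarrow> 'e \<Rightarrow> real"
  assumes \<alpha>: "0 < \<alpha>" and g: "g \<in> Lp_plus m \<alpha>" and gs: "\<And>n. gs n \<in> Lp_plus m \<alpha>"
  shows "(\<lambda>n. \<integral>\<^sup>+x. ennreal \<bar>gs n x powr \<alpha> - g x powr \<alpha>\<bar> \<partial>m) \<longlonglongrightarrow> 0
      \<longleftrightarrow> (\<lambda>n. \<integral>\<^sup>+x. ennreal (\<bar>gs n x - g x\<bar> powr \<alpha>) \<partial>m) \<longlonglongrightarrow> 0"
proof -
  have [measurable]: "g \<in> borel_measurable m" "gs n \<in> borel_measurable m" for n
    using g gs by (auto simp: Lp_plus_def)
  have pos: "0 \<le> g x" "0 \<le> gs n x" if "x \<in> space m" for x n using that g gs by (auto simp: Lp_plus_def)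
  have fin: "(\<integral>\<^sup>+x. ennreal (g x powr \<alpha>) \<partial>m) < \<infinity>" using g by (auto simp: Lp_plus_def)
  show ?thesis
  proof
    assume A: "(\<lambda>n. \<integral>\<^sup>+x. ennreal \<bar>gs n x powr \<alpha> - g x powr \<alpha>\<bar> \<partial>m) \<longlonglongrightarrow> 0"
    show "(\<lambda>n. \<integral>\<^sup>+x. ennreal (\<bar>gs n x - g x\<bar> powr \<alpha>) \<partial>m) \<longlonglongrightarrow> 0"
    proof (rule nn_integral_tendsto_0_comparison[OF A fin])
      fix \<epsilon> :: real assume "0 < \<epsilon>"
      then obtain C where "0 \<le> C"
        "\<And>a b. 0 \<le> a \<Longrightarrow> 0 \<le> b \<Longrightarrow> \<bar>a - b\<bar> powr \<alpha> \<le> \<epsilon> * b powr \<alpha> + C * \<bar>a powr \<alpha> - b powr \<alpha>\<bar>"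
        using abs_diff_powr_le[OF \<alpha>] by blast
      then show "\<exists>C\<ge>0. \<forall>n. \<forall>x\<in>space m.
          \<bar>gs n x - g x\<bar> powr \<alpha> \<le> \<epsilon> * g x powr \<alpha> + C * \<bar>gs n x powr \<alpha> - g x powr \<alpha>\<bar>"
        using pos by (intro exI[of _ C]) auto
    qed auto
  next
    assume A: "(\<lambda>n. \<integral>\<^sup>+x. ennreal (\<bar>gs n x - g x\<bar> powr \<alpha>) \<partial>m) \<longlonglongrightarrow> 0"
    show "(\<lambda>n. \<integral>\<^sup>+x. ennreal \<bar>gs n x powr \<alpha> - g x powr \<alpha>\<bar> \<partial>m) \<longlonglongrightarrow> 0"
    proof (rule nn_integral_tendsto_0_comparison[OF A fin])
      fix \<epsilon> :: real assume "0 < \<epsilon>"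
      then obtain C where "0 \<le> C"
        "\<And>a b. 0 \<le> a \<Longrightarrow> 0 \<le> b \<Longrightarrow> \<bar>a powr \<alpha> - b powr \<alpha>\<bar> \<le> \<epsilon> * b powr \<alpha> + C * \<bar>a - b\<bar> powr \<alpha>"
        using abs_powr_diff_le[OF \<alpha>] by blast
      then show "\<exists>C\<ge>0. \<forall>n. \<forall>x\<in>space m.
          \<bar>gs n x powr \<alpha> - g x powr \<alpha>\<bar> \<le> \<epsilon> * g x powr \<alpha> + C * \<bar>gs n x - g x\<bar> powr \<alpha>"
        using pos by (intro exI[of _ C]) auto
    qed auto
  qed
qed

section \<open>Convergence in probability\<close>

context prob_space
begin

lemma prob_dist_triangle:
  fixes X Y Z :: "'a \<Rightarrow> 'b::{second_countable_topology,metric_space}"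
  assumes [measurable]: "X \<in> borel_measurable M" "Y \<in> borel_measurable M" "Z \<in> borel_measurable M"
    and \<epsilon>: "a + b \<le> \<epsilon>"
  shows "prob {\<omega> \<in> space M. \<epsilon> < dist (X \<omega>) (Z \<omega>)}
    \<le> prob {\<omega> \<in> space M. a < dist (X \<omega>) (Y \<omega>)} + prob {\<omega> \<in> space M. b < dist (Y \<omega>) (Z \<omega>)}"
proof -
  have "prob {\<omega> \<in> space M. \<epsilon> < dist (X \<omega>) (Z \<omega>)}
      \<le> prob ({\<omega> \<in> space M. a < dist (X \<omega>) (Y \<omega>)} \<union> {\<omega> \<in> space M. b < dist (Y \<omega>) (Z \<omega>)})"
  proof (intro finite_measure_mono subsetI)
    fix \<omega> assume "\<omega> \<in> {\<omega> \<in> space M. \<epsilon> < dist (X \<omega>) (Z \<omega>)}"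
    then show "\<omega> \<in> {\<omega> \<in> space M. a < dist (X \<omega>) (Y \<omega>)} \<union> {\<omega> \<in> space M. b < dist (Y \<omega>) (Z \<omega>)}"
      using \<epsilon> dist_triangle[of "X \<omega>" "Z \<omega>" "Y \<omega>"] by auto
  qed measurable
  also have "\<dots> \<le> prob {\<omega> \<in> space M. a < dist (X \<omega>) (Y \<omega>)} + prob {\<omega> \<in> space M. b < dist (Y \<omega>) (Z \<omega>)}"
    by (intro measure_Un_le) measurable
  finally show ?thesis .
qed

text \<open>One parameter serves both as the tolerance and as the bound on the probability. In this form
statements about convergence in probability compose like statements in a metric space.\<close>

lemma tendsto_in_prob_iff_Ky_Fan:
  fixes X :: "nat \<Rightarrow> 'a \<Rightarrow> 'b::{second_countable_topology,metric_space}"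
  assumes [measurable]: "\<And>n. X n \<in> borel_measurable M" "Y \<in> borel_measurable M"
  shows "tendsto_in_prob M X Y \<longleftrightarrow>
    (\<forall>\<epsilon>>0. \<forall>\<^sub>F n in sequentially. prob {\<omega> \<in> space M. \<epsilon> < dist (X n \<omega>) (Y \<omega>)} \<le> \<epsilon>)"
proof
  assume L: "tendsto_in_prob M X Y"
  show "\<forall>\<epsilon>>0. \<forall>\<^sub>F n in sequentially. prob {\<omega> \<in> space M. \<epsilon> < dist (X n \<omega>) (Y \<omega>)} \<le> \<epsilon>"
  proof (intro allI impI)
    fix \<epsilon> :: real assume \<epsilon>: "0 < \<epsilon>"
    then have "(\<lambda>n. prob {\<omega> \<in> space M. \<epsilon> < dist (X n \<omega>) (Y \<omega>)}) \<longlonglongrightarrow> 0"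
      using L by (auto simp: tendsto_in_prob_def)
    from order_tendstoD(2)[OF this \<epsilon>]
    show "\<forall>\<^sub>F n in sequentially. prob {\<omega> \<in> space M. \<epsilon> < dist (X n \<omega>) (Y \<omega>)} \<le> \<epsilon>"
      by (rule eventually_mono) simp
  qed
next
  assume R: "\<forall>\<epsilon>>0. \<forall>\<^sub>F n in sequentially. prob {\<omega> \<in> space M. \<epsilon> < dist (X n \<omega>) (Y \<omega>)} \<le> \<epsilon>"
  show "tendsto_in_prob M X Y"
    unfolding tendsto_in_prob_def
  proof (intro allI impI)
    fix \<epsilon> :: real assume \<epsilon>: "0 < \<epsilon>"
    show "(\<lambda>n. prob {\<omega> \<in> space M. \<epsilon> < dist (X n \<omega>) (Y \<omega>)}) \<longlonglongrightarrow> 0"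
    proof (rule order_tendstoI)
      fix e :: real assume e: "0 < e"
      then have "0 < min \<epsilon> (e / 2)" using \<epsilon> by simp
      then have "\<forall>\<^sub>F n in sequentially.
          prob {\<omega> \<in> space M. min \<epsilon> (e / 2) < dist (X n \<omega>) (Y \<omega>)} \<le> min \<epsilon> (e / 2)" using R by blast
      then show "\<forall>\<^sub>F n in sequentially. prob {\<omega> \<in> space M. \<epsilon> < dist (X n \<omega>) (Y \<omega>)} < e"
      proof (rule eventually_mono)
        fix n assume *: "prob {\<omega> \<in> space M. min \<epsilon> (e / 2) < dist (X n \<omega>) (Y \<omega>)} \<le> min \<epsilon> (e / 2)"
        have "prob {\<omega> \<in> space M. \<epsilon> < dist (X n \<omega>) (Y \<omega>)}
            \<le> prob {\<omega> \<in> space M. min \<epsilon> (e / 2) < dist (X n \<omega>) (Y \<omega>)}"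
          by (intro finite_measure_mono) auto
        then show "prob {\<omega> \<in> space M. \<epsilon> < dist (X n \<omega>) (Y \<omega>)} < e" using * e by auto
      qed
    next
      fix e :: real assume "e < 0"
      then show "\<forall>\<^sub>F n in sequentially. e < prob {\<omega> \<in> space M. \<epsilon> < dist (X n \<omega>) (Y \<omega>)}"
        by (intro always_eventually allI) (meson less_le_trans measure_nonneg)
    qed
  qed
qed

lemma AE_tendsto_imp_tendsto_in_prob:
  fixes X :: "nat \<Rightarrow> 'a \<Rightarrow> 'b::{second_countable_topology,metric_space}"
  assumes [measurable]: "\<And>n. X n \<in> borel_measurable M" "Y \<in> borel_measurable M"
    and AE: "AE \<omega> in M. (\<lambda>n. X n \<omega>) \<longlonglongrightarrow> Y \<omega>"
  shows "tendsto_in_prob M X Y"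
  unfolding tendsto_in_prob_def
proof (intro allI impI)
  fix \<epsilon> :: real assume \<epsilon>: "0 < \<epsilon>"
  let ?A = "\<lambda>n. {\<omega> \<in> space M. \<epsilon> < dist (X n \<omega>) (Y \<omega>)}"
  have "(\<lambda>n. \<integral>\<omega>. indicator (?A n) \<omega> \<partial>M) \<longlonglongrightarrow> (\<integral>\<omega>. (0::real) \<partial>M)"
  proof (rule integral_dominated_convergence[where w = "\<lambda>_. 1"])
    show "AE \<omega> in M. (\<lambda>n. indicat_real (?A n) \<omega>) \<longlonglongrightarrow> 0"
      using AE
    proof eventually_elim
      case (elim \<omega>)
      have "\<forall>\<^sub>F n in sequentially. indicat_real (?A n) \<omega> = 0"
        using tendstoD[OF elim \<epsilon>] by (rule eventually_mono) (auto simp: indicator_def)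
      then show ?case by (rule tendsto_eventually)
    qed
  qed (auto simp: indicator_def)
  then show "(\<lambda>n. prob (?A n)) \<longlonglongrightarrow> 0" by simp
qed

text \<open>Completeness of convergence in probability. A subsequence with summable error probabilities
converges almost surely by the Borel-Cantelli lemma, and the Cauchy property brings the remaining
terms along.\<close>

lemma Cauchy_in_prob_imp_tendsto_in_prob:
  fixes X :: "nat \<Rightarrow> 'a \<Rightarrow> 'b::{second_countable_topology,banach}"
  assumes [measurable]: "\<And>n. X n \<in> borel_measurable M"
    and Cauchy: "\<And>\<epsilon>. 0 < \<epsilon> \<Longrightarrow> \<exists>N. \<forall>i\<ge>N. \<forall>j\<ge>N. prob {\<omega> \<in> space M. \<epsilon> < dist (X i \<omega>) (X j \<omega>)} \<le> \<epsilon>"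
  obtains Y where "Y \<in> borel_measurable M" "tendsto_in_prob M X Y"
proof -
  have "\<forall>k. \<exists>N. \<forall>i\<ge>N. \<forall>j\<ge>N. prob {\<omega> \<in> space M. (1/2)^k < dist (X i \<omega>) (X j \<omega>)} \<le> (1/2)^k"
    using Cauchy by simp
  then obtain N :: "nat \<Rightarrow> nat" where N: "\<And>k i j. N k \<le> i \<Longrightarrow> N k \<le> j \<Longrightarrow>
      prob {\<omega> \<in> space M. (1/2)^k < dist (X i \<omega>) (X j \<omega>)} \<le> (1/2)^k"
    by metis
  \<comment> \<open>\<open>r k \<ge> k\<close> makes the indices tend to infinity, and \<open>N k\<close> is a lower bound of both \<open>r k\<close> and
    \<open>r (Suc k)\<close>, so that consecutive terms are close.\<close>
  define r where "r k = k + (\<Sum>i\<le>k. N i)" for k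
  have r: "k \<le> r k" "N k \<le> r k" "N k \<le> r (Suc k)" for k
  proof -
    have "N k \<le> (\<Sum>i\<le>k. N i)" by (intro member_le_sum) auto
    then show "k \<le> r k" "N k \<le> r k" "N k \<le> r (Suc k)" by (auto simp: r_def)
  qed
  define Y where "Y \<omega> = lim (\<lambda>k. X (r k) \<omega>)" for \<omega>
  have Y[measurable]: "Y \<in> borel_measurable M" unfolding Y_def by measurable
  let ?A = "\<lambda>k. {\<omega> \<in> space M. (1/2)^k < dist (X (r k) \<omega>) (X (r (Suc k)) \<omega>)}"
  have "AE \<omega> in M. \<forall>\<^sub>F k in sequentially. \<omega> \<in> space M - ?A k"
  proof (rule borel_cantelli_AE1)
    show "summable (\<lambda>k. prob (?A k))"
      using N r by (intro summable_comparison_test'[OF summable_geometric[of "1/2::real"]]) auto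
  qed (auto simp: emeasure_eq_measure)
  then have "AE \<omega> in M. (\<lambda>k. X (r k) \<omega>) \<longlonglongrightarrow> Y \<omega>"
  proof eventually_elim
    case (elim \<omega>)
    then obtain K where "\<And>k. K \<le> k \<Longrightarrow> dist (X (r k) \<omega>) (X (r (Suc k)) \<omega>) \<le> (1/2)^k"
      unfolding eventually_sequentially by (force simp: not_less)
    then have "norm (X (r (Suc k)) \<omega> - X (r k) \<omega>) \<le> (1/2)^k" if "K \<le> k" for k
      using that by (simp add: dist_norm norm_minus_commute)
    then have "summable (\<lambda>k. X (r (Suc k)) \<omega> - X (r k) \<omega>)"
      by (intro summable_comparison_test'[OF summable_geometric[of "1/2::real"]]) auto
    then have "convergent (\<lambda>k. X (r k) \<omega> - X (r 0) \<omega>)"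
      using sum_lessThan_telescope[of "\<lambda>k. X (r k) \<omega>"] by (simp add: summable_iff_convergent)
    then have "convergent (\<lambda>k. X (r k) \<omega>)" using convergent_diff_const_right_iff by blast
    then show ?case unfolding Y_def by (simp add: convergent_LIMSEQ_iff)
  qed
  then have sub: "tendsto_in_prob M (\<lambda>k. X (r k)) Y" by (intro AE_tendsto_imp_tendsto_in_prob) measurable
  have "tendsto_in_prob M X Y"
  proof (subst tendsto_in_prob_iff_Ky_Fan, measurable, intro allI impI)
    fix \<epsilon> :: real assume "0 < \<epsilon>"
    then have \<epsilon>: "0 < \<epsilon> / 2" by simp
    obtain L where L: "\<And>i j. L \<le> i \<Longrightarrow> L \<le> j \<Longrightarrow> prob {\<omega> \<in> space M. \<epsilon> / 2 < dist (X i \<omega>) (X j \<omega>)} \<le> \<epsilon> / 2"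
      using Cauchy[OF \<epsilon>] by blast
    have "\<forall>\<^sub>F k in sequentially. prob {\<omega> \<in> space M. \<epsilon> / 2 < dist (X (r k) \<omega>) (Y \<omega>)} \<le> \<epsilon> / 2"
      using iffD1[OF tendsto_in_prob_iff_Ky_Fan sub, OF assms(1) Y] \<epsilon> by blast
    then obtain k where k: "L \<le> k" "prob {\<omega> \<in> space M. \<epsilon> / 2 < dist (X (r k) \<omega>) (Y \<omega>)} \<le> \<epsilon> / 2"
      unfolding eventually_sequentially by (meson nle_le)
    have "prob {\<omega> \<in> space M. \<epsilon> < dist (X n \<omega>) (Y \<omega>)} \<le> \<epsilon>" if "L \<le> n" for n
    proof -
      have "prob {\<omega> \<in> space M. \<epsilon> < dist (X n \<omega>) (Y \<omega>)} \<le>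
          prob {\<omega> \<in> space M. \<epsilon> / 2 < dist (X n \<omega>) (X (r k) \<omega>)} + prob {\<omega> \<in> space M. \<epsilon> / 2 < dist (X (r k) \<omega>) (Y \<omega>)}"
        by (intro prob_dist_triangle) auto
      also have "\<dots> \<le> \<epsilon> / 2 + \<epsilon> / 2" using k L[of n "r k"] that r(1)[of k] by (intro add_mono) auto
      finally show ?thesis by simp
    qed
    then show "\<forall>\<^sub>F n in sequentially. prob {\<omega> \<in> space M. \<epsilon> < dist (X n \<omega>) (Y \<omega>)} \<le> \<epsilon>"
      unfolding eventually_sequentially by blast
  qed
  with Y show thesis by (rule that)
qed

lemma random_variable_tight:
  fixes X :: "'a \<Rightarrow> 'b::{second_countable_topology,real_normed_vector}"
  assumes [measurable]: "X \<in> borel_measurable M" and e: "0 < e"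
  obtains R :: real where "0 < R" "prob {\<omega> \<in> space M. R < norm (X \<omega>)} < e"
proof -
  let ?A = "\<lambda>n::nat. {\<omega> \<in> space M. real n < norm (X \<omega>)}"
  have "(\<lambda>n. prob (?A n)) \<longlonglongrightarrow> prob (\<Inter>n. ?A n)"
    by (intro finite_Lim_measure_decseq) (auto simp: decseq_def)
  moreover have "\<exists>n. \<not> real n < norm (X \<omega>)" for \<omega>
    using reals_Archimedean2[of "norm (X \<omega>)"] less_asym by blast
  then have "(\<Inter>n. ?A n) = {}" by blast
  ultimately have "(\<lambda>n. prob (?A n)) \<longlonglongrightarrow> 0" by simp
  then have "\<forall>\<^sub>F n in sequentially. prob (?A n) < e \<and> 0 < n"
    using e by (intro eventually_conj order_tendstoD(2) eventually_gt_at_top)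
  then obtain n where "prob (?A n) < e" "0 < n" unfolding eventually_sequentially by auto
  then show thesis by (intro that[of "real n"]) auto
qed

text \<open>A continuous map need not be uniformly continuous, but it is so on a ball that contains the limit
with probability close to \<open>1\<close>.\<close>

lemma tendsto_in_prob_continuous_map:
  fixes X :: "nat \<Rightarrow> 'a \<Rightarrow> 'b::euclidean_space" and h :: "'b \<Rightarrow> 'c::{second_countable_topology,metric_space}"
  assumes X[measurable]: "\<And>n. X n \<in> borel_measurable M" "Y \<in> borel_measurable M"
    and lim: "tendsto_in_prob M X Y" and cont: "continuous_on UNIV h"
  shows "tendsto_in_prob M (\<lambda>n \<omega>. h (X n \<omega>)) (\<lambda>\<omega>. h (Y \<omega>))"
proof -
  have [measurable]: "h \<in> borel_measurable borel" using cont by (rule borel_measurable_continuous_onI)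
  show ?thesis
  proof (subst tendsto_in_prob_iff_Ky_Fan, measurable, intro allI impI)
    fix \<epsilon> :: real assume \<epsilon>: "0 < \<epsilon>"
    obtain R where R: "0 < R" "prob {\<omega> \<in> space M. R < norm (Y \<omega>)} < \<epsilon> / 2"
      using random_variable_tight[of Y "\<epsilon> / 2"] \<epsilon> by auto
    have "uniformly_continuous_on (cball 0 (R + 1)) h"
      using cont by (intro compact_uniformly_continuous continuous_on_subset[OF cont]) auto
    then obtain \<delta> where \<delta>: "0 < \<delta>" "\<And>x y. x \<in> cball 0 (R + 1) \<Longrightarrow> y \<in> cball 0 (R + 1) \<Longrightarrow> dist y x < \<delta> \<Longrightarrow> dist (h y) (h x) < \<epsilon>"
      unfolding uniformly_continuous_on_def using \<epsilon> by metis
    define d where "d = min (\<delta> / 2) 1"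
    have d: "0 < d" "d < \<delta>" "d \<le> 1" using \<delta> by (auto simp: d_def)
    have "(\<lambda>n. prob {\<omega> \<in> space M. d < dist (X n \<omega>) (Y \<omega>)}) \<longlonglongrightarrow> 0"
      using lim d by (auto simp: tendsto_in_prob_def)
    then have "\<forall>\<^sub>F n in sequentially. prob {\<omega> \<in> space M. d < dist (X n \<omega>) (Y \<omega>)} < \<epsilon> / 2"
      using \<epsilon> by (intro order_tendstoD(2)) auto
    then show "\<forall>\<^sub>F n in sequentially. prob {\<omega> \<in> space M. \<epsilon> < dist (h (X n \<omega>)) (h (Y \<omega>))} \<le> \<epsilon>"
    proof (rule eventually_mono)
      fix n assume n: "prob {\<omega> \<in> space M. d < dist (X n \<omega>) (Y \<omega>)} < \<epsilon> / 2"
      have "prob {\<omega> \<in> space M. \<epsilon> < dist (h (X n \<omega>)) (h (Y \<omega>))} \<le>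
          prob ({\<omega> \<in> space M. R < norm (Y \<omega>)} \<union> {\<omega> \<in> space M. d < dist (X n \<omega>) (Y \<omega>)})"
      proof (intro finite_measure_mono subsetI)
        fix \<omega> assume w: "\<omega> \<in> {\<omega> \<in> space M. \<epsilon> < dist (h (X n \<omega>)) (h (Y \<omega>))}"
        show "\<omega> \<in> {\<omega> \<in> space M. R < norm (Y \<omega>)} \<union> {\<omega> \<in> space M. d < dist (X n \<omega>) (Y \<omega>)}"
        proof (rule ccontr)
          assume c: "\<not> ?thesis"
          then have "norm (Y \<omega>) \<le> R" "dist (X n \<omega>) (Y \<omega>) \<le> d" using w by auto
          moreover have "norm (X n \<omega>) \<le> norm (Y \<omega>) + dist (X n \<omega>) (Y \<omega>)"
            by (simp add: dist_norm norm_triangle_sub)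
          ultimately have "dist (h (X n \<omega>)) (h (Y \<omega>)) < \<epsilon>" using d R by (intro \<delta>(2)) auto
          then show False using w by simp
        qed
      qed measurable
      also have "\<dots> \<le> prob {\<omega> \<in> space M. R < norm (Y \<omega>)} + prob {\<omega> \<in> space M. d < dist (X n \<omega>) (Y \<omega>)}"
        by (intro measure_Un_le) measurable
      finally show "prob {\<omega> \<in> space M. \<epsilon> < dist (h (X n \<omega>)) (h (Y \<omega>))} \<le> \<epsilon>" using R n by simp
    qed
  qed
qed

lemma cdf_le_cdf_add_prob_dist:
  fixes U V :: "'a \<Rightarrow> real"
  assumes [measurable]: "U \<in> borel_measurable M" "V \<in> borel_measurable M"
  shows "prob {\<omega> \<in> space M. U \<omega> \<le> x} \<le>
    prob {\<omega> \<in> space M. V \<omega> \<le> x + \<eta>} + prob {\<omega> \<in> space M. \<eta> < dist (U \<omega>) (V \<omega>)}"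
proof -
  have "prob {\<omega> \<in> space M. U \<omega> \<le> x}
      \<le> prob ({\<omega> \<in> space M. V \<omega> \<le> x + \<eta>} \<union> {\<omega> \<in> space M. \<eta> < dist (U \<omega>) (V \<omega>)})"
    by (intro finite_measure_mono) (auto simp: dist_real_def)
  also have "\<dots> \<le> prob {\<omega> \<in> space M. V \<omega> \<le> x + \<eta>} + prob {\<omega> \<in> space M. \<eta> < dist (U \<omega>) (V \<omega>)}"
    by (intro measure_Un_le) measurable
  finally show ?thesis .
qed

text \<open>The distribution function of the limit at \<open>x\<close> is squeezed between the values of \<open>F\<close> at slightly smaller
and slightly larger arguments; continuity of \<open>F\<close> at \<open>x\<close> closes the gap.\<close>

lemma cdf_of_limit_in_prob:
  fixes W :: "nat \<Rightarrow> 'a \<Rightarrow> real"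
  assumes [measurable]: "\<And>n. W n \<in> borel_measurable M" "V \<in> borel_measurable M"
    and lim: "tendsto_in_prob M W V"
    and cdf: "\<And>y. 0 < y \<Longrightarrow> (\<lambda>n. prob {\<omega> \<in> space M. W n \<omega> \<le> y}) \<longlonglongrightarrow> F y"
    and x: "0 < x" and cont: "isCont F x"
  shows "prob {\<omega> \<in> space M. V \<omega> \<le> x} = F x"
proof (rule antisym)
  let ?D = "\<lambda>\<eta> n. prob {\<omega> \<in> space M. \<eta> < dist (W n \<omega>) (V \<omega>)}"
  have D: "?D \<eta> \<longlonglongrightarrow> 0" if "0 < \<eta>" for \<eta> using lim that by (auto simp: tendsto_in_prob_def)
  have right: "(F \<longlongrightarrow> F x) (at_right x)" and left: "(F \<longlongrightarrow> F x) (at_left x)"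
    using cont by (auto simp: isCont_def filterlim_at_split)
  have "prob {\<omega> \<in> space M. V \<omega> \<le> x} \<le> F y" if y: "x < y" for y
  proof (rule LIMSEQ_le_const)
    show "(\<lambda>n. prob {\<omega> \<in> space M. W n \<omega> \<le> y} + ?D (y - x) n) \<longlonglongrightarrow> F y"
      using tendsto_add[OF cdf[of y] D[of "y - x"]] x y by simp
    show "\<exists>N. \<forall>n\<ge>N. prob {\<omega> \<in> space M. V \<omega> \<le> x} \<le> prob {\<omega> \<in> space M. W n \<omega> \<le> y} + ?D (y - x) n"
      using cdf_le_cdf_add_prob_dist[of V "W _" x "y - x"] by (auto simp: dist_commute)
  qed
  then have "\<forall>\<^sub>F y in at_right x. prob {\<omega> \<in> space M. V \<omega> \<le> x} \<le> F y"
    by (auto simp: eventually_at_right_less intro: eventually_mono[OF eventually_at_right_less])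
  with right show "prob {\<omega> \<in> space M. V \<omega> \<le> x} \<le> F x" by (rule tendsto_lowerbound) simp
  have "F y \<le> prob {\<omega> \<in> space M. V \<omega> \<le> x}" if y: "0 < y" "y < x" for y
  proof (rule LIMSEQ_le)
    show "(\<lambda>n. prob {\<omega> \<in> space M. W n \<omega> \<le> y}) \<longlonglongrightarrow> F y" by (rule cdf[OF y(1)])
    show "(\<lambda>n. prob {\<omega> \<in> space M. V \<omega> \<le> x} + ?D (x - y) n) \<longlonglongrightarrow> prob {\<omega> \<in> space M. V \<omega> \<le> x}"
      using tendsto_add[OF tendsto_const D[of "x - y"]] y by simp
    show "\<exists>N. \<forall>n\<ge>N. prob {\<omega> \<in> space M. W n \<omega> \<le> y} \<le> prob {\<omega> \<in> space M. V \<omega> \<le> x} + ?D (x - y) n"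
      using cdf_le_cdf_add_prob_dist[of "W _" V y "x - y"] by auto
  qed
  moreover have "\<forall>\<^sub>F y in at_left x. y \<in> {0<..<x}"
    using x by (rule eventually_at_left_real)
  ultimately have "\<forall>\<^sub>F y in at_left x. F y \<le> prob {\<omega> \<in> space M. V \<omega> \<le> x}"
    by (auto elim: eventually_mono)
  with left show "F x \<le> prob {\<omega> \<in> space M. V \<omega> \<le> x}" by (rule tendsto_upperbound) simp
qed

text \<open>The events \<open>U n \<le> x\<close> and \<open>V \<le> x\<close> differ only if \<open>U n\<close> is far from \<open>V\<close> or \<open>V\<close> is close to \<open>x\<close>. The
intersection with a fixed event \<open>A\<close> gives access to the joint law of \<open>U n\<close> and \<open>V\<close>.\<close>

lemma tendsto_in_prob_imp_prob_le_tendsto: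
  fixes U :: "nat \<Rightarrow> 'a \<Rightarrow> real"
  assumes [measurable]: "\<And>n. U n \<in> borel_measurable M" "V \<in> borel_measurable M"
    and lim: "tendsto_in_prob M U V"
    and cont: "isCont (\<lambda>y. prob {\<omega> \<in> space M. V \<omega> \<le> y}) x"
    and A[measurable]: "A \<in> events"
  shows "(\<lambda>n. prob ({\<omega> \<in> space M. U n \<omega> \<le> x} \<inter> A)) \<longlonglongrightarrow> prob ({\<omega> \<in> space M. V \<omega> \<le> x} \<inter> A)"
proof (rule LIMSEQ_I)
  fix e :: real assume e: "0 < e"
  define F where "F y = prob {\<omega> \<in> space M. V \<omega> \<le> y}" for y
  obtain d where d: "0 < d" "\<And>y. y \<noteq> x \<Longrightarrow> \<bar>y - x\<bar> < d \<Longrightarrow> \<bar>F y - F x\<bar> < e / 3"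
    using LIM_D[OF cont[unfolded isCont_def], of "e / 3"] e by (auto simp: F_def)
  define \<eta> where "\<eta> = d / 2"
  have \<eta>: "0 < \<eta>" using d by (simp add: \<eta>_def)
  have F: "F (x + \<eta>) - F x < e / 3" "F x - F (x - \<eta>) < e / 3"
    using d(2)[of "x + \<eta>"] d(2)[of "x - \<eta>"] d(1) unfolding \<eta>_def by linarith+
  let ?D = "\<lambda>n. {\<omega> \<in> space M. \<eta> < dist (U n \<omega>) (V \<omega>)}"
  let ?u = "\<lambda>n. {\<omega> \<in> space M. U n \<omega> \<le> x} \<inter> A" and ?v = "{\<omega> \<in> space M. V \<omega> \<le> x} \<inter> A"
  let ?B = "{\<omega> \<in> space M. x - \<eta> < V \<omega> \<and> V \<omega> \<le> x + \<eta>}"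
  have B: "prob ?B = F (x + \<eta>) - F (x - \<eta>)"
  proof -
    have "?B = {\<omega> \<in> space M. V \<omega> \<le> x + \<eta>} - {\<omega> \<in> space M. V \<omega> \<le> x - \<eta>}" by auto
    moreover have "prob ({\<omega> \<in> space M. V \<omega> \<le> x + \<eta>} - {\<omega> \<in> space M. V \<omega> \<le> x - \<eta>}) = F (x + \<eta>) - F (x - \<eta>)"
      unfolding F_def using \<eta> by (intro finite_measure_Diff) auto
    ultimately show ?thesis by simp
  qed
  have "(\<lambda>n. prob (?D n)) \<longlonglongrightarrow> 0" using lim \<eta> by (auto simp: tendsto_in_prob_def)
  then have "\<forall>\<^sub>F n in sequentially. prob (?D n) < e / 3" using e by (intro order_tendstoD(2)) auto
  then obtain N where N: "\<And>n. N \<le> n \<Longrightarrow> prob (?D n) < e / 3" unfolding eventually_sequentially by blast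
  have "norm (prob (?u n) - prob ?v) < e" if "N \<le> n" for n
  proof -
    have "prob (?u n) \<le> prob (?v \<union> (?D n \<union> ?B))"
      by (intro finite_measure_mono) (auto simp: dist_real_def)
    also have "\<dots> \<le> prob ?v + prob (?D n \<union> ?B)" by (intro measure_Un_le) measurable
    also have "prob (?D n \<union> ?B) \<le> prob (?D n) + prob ?B" by (intro measure_Un_le) measurable
    finally have 1: "prob (?u n) \<le> prob ?v + (prob (?D n) + prob ?B)" by simp
    have "prob ?v \<le> prob (?u n \<union> (?D n \<union> ?B))"
      by (intro finite_measure_mono) (auto simp: dist_real_def)
    also have "\<dots> \<le> prob (?u n) + prob (?D n \<union> ?B)" by (intro measure_Un_le) measurable
    also have "prob (?D n \<union> ?B) \<le> prob (?D n) + prob ?B" by (intro measure_Un_le) measurable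
    finally have 2: "prob ?v \<le> prob (?u n) + (prob (?D n) + prob ?B)" by simp
    show ?thesis using 1 2 B F N[OF that] by auto
  qed
  then show "\<exists>N. \<forall>n\<ge>N. norm (prob (?u n) - prob ?v) < e" by blast
qed

lemma tendsto_in_prob_max:
  fixes U V :: "nat \<Rightarrow> 'a \<Rightarrow> real"
  assumes [measurable]: "\<And>n. U n \<in> borel_measurable M" "\<And>n. V n \<in> borel_measurable M"
    "u \<in> borel_measurable M" "v \<in> borel_measurable M"
    and lim: "tendsto_in_prob M U u" "tendsto_in_prob M V v"
  shows "tendsto_in_prob M (\<lambda>n \<omega>. max (U n \<omega>) (V n \<omega>)) (\<lambda>\<omega>. max (u \<omega>) (v \<omega>))"
  unfolding tendsto_in_prob_def
proof (intro allI impI)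
  fix \<epsilon> :: real assume \<epsilon>: "0 < \<epsilon>"
  let ?A = "\<lambda>n. {\<omega> \<in> space M. \<epsilon> < dist (U n \<omega>) (u \<omega>)}" and ?B = "\<lambda>n. {\<omega> \<in> space M. \<epsilon> < dist (V n \<omega>) (v \<omega>)}"
  let ?C = "\<lambda>n. {\<omega> \<in> space M. \<epsilon> < dist (max (U n \<omega>) (V n \<omega>)) (max (u \<omega>) (v \<omega>))}"
  have sum: "(\<lambda>n. prob (?A n) + prob (?B n)) \<longlonglongrightarrow> 0"
    using lim \<epsilon> by (intro tendsto_add_zero) (auto simp: tendsto_in_prob_def)
  have le: "prob (?C n) \<le> prob (?A n) + prob (?B n)" for n
  proof -
    have "prob (?C n) \<le> prob (?A n \<union> ?B n)"
      by (intro finite_measure_mono) (auto simp: dist_real_def max_def split: if_splits)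
    also have "\<dots> \<le> prob (?A n) + prob (?B n)" by (intro measure_Un_le) measurable
    finally show ?thesis .
  qed
  show "(\<lambda>n. prob (?C n)) \<longlonglongrightarrow> 0"
    by (rule tendsto_sandwich[OF always_eventually always_eventually tendsto_const sum]) (use le in auto)
qed

end

section \<open>The law of the loss under a sup-measure\<close>

context loss_function
begin

lemma f_borel_measurable[measurable]: "f \<in> borel_measurable borel"
  using continuous by (rule borel_measurable_continuous_onI)

lemma f_zero[simp]: "f 0 = 0"
  using eq_0_iff by blast

text \<open>\<open>f\<close> attains a positive minimum on the unit sphere; homogeneity does the rest.\<close>

lemma norm_le_f:
  obtains C where "0 < C" "\<And>v. norm v \<le> C * f v"
proof -
  have "compact (sphere (0 :: real ^ 'd) 1)" "sphere (0 :: real ^ 'd) 1 \<noteq> {}" by auto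
  then obtain u where u: "u \<in> sphere (0 :: real ^ 'd) 1" "\<And>v. v \<in> sphere 0 1 \<Longrightarrow> f u \<le> f v"
    using continuous_attains_inf[of "sphere 0 1" f] continuous_on_subset[OF continuous] by blast
  have pos: "0 < f u" using u(1) nonneg[of u] eq_0_iff[of u] by (cases "f u = 0") auto
  have "norm v \<le> (1 / f u) * f v" for v
  proof (cases "v = 0")
    case False
    have "f u \<le> f (v /\<^sub>R norm v)" using False by (intro u(2)) simp
    also have "\<dots> = f v / norm v" using homogeneous[of "inverse (norm v)" v] by (simp add: field_simps)
    finally show ?thesis using False pos by (simp add: field_simps)
  qed simp
  with pos show thesis by (intro that[of "1 / f u"]) auto
qed

end

text \<open>The distribution function vanishes strictly below \<open>0\<close>, and the open negative half-line is the union
of the closed half-lines that end there.\<close>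

lemma frechet_law_negative_null:
  assumes "frechet_law \<alpha> \<sigma> N"
  shows "emeasure N {..<0} = 0"
proof -
  interpret N: real_distribution N using assms by (simp add: frechet_law_def)
  have "{..<0::real} = (\<Union>n. {..- 1 / real (Suc n)})"
  proof (intro equalityI subsetI)
    fix x :: real assume "x \<in> {..<0}"
    then obtain n where "inverse (real (Suc n)) < - x" using reals_Archimedean[of "- x"] by auto
    then show "x \<in> (\<Union>n. {..- 1 / real (Suc n)})" by (intro UN_I[of n]) (auto simp: inverse_eq_divide)
  next
    fix x :: real assume "x \<in> (\<Union>n. {..- 1 / real (Suc n)})"
    then obtain n where "x \<le> - 1 / real (Suc n)" by blast
    also have "\<dots> < 0" by (simp add: field_simps)
    finally show "x \<in> {..<0}" by simp
  qed
  moreover have "emeasure N (\<Union>n. {..- 1 / real (Suc n)}) = 0"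
  proof (rule emeasure_UN_eq_0)
    fix n
    have "cdf N (- 1 / real (Suc n)) = 0" using assms by (simp add: frechet_law_def)
    then show "emeasure N {..- 1 / real (Suc n)} = 0" by (simp add: cdf_def N.emeasure_eq_measure)
  qed auto
  ultimately show ?thesis by simp
qed

context implicit_frechet_sup_measure
begin

lemma M_measurable[measurable]: "A \<in> fmeasurable m \<Longrightarrow> M A \<in> borel_measurable P"
  by (rule random_vector)

lemma space_kappa: "space \<kappa> = {x. f x = 1}"
  using sets_eq_imp_space_eq[OF sets_kappa] by (simp add: space_restrict_space)

text \<open>As \<open>f (z \<theta>) = z\<close> for \<open>z \<ge> 0\<close> and \<open>\<theta>\<close> on the unit level set of \<open>f\<close>, the loss of \<open>M A\<close> is the radial
part \<open>\<sigma> Z\<close>, a real Frechet variable.\<close>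

lemma prob_f_M_le:
  assumes A: "A \<in> fmeasurable m" and x: "0 < x"
  shows "P.prob {\<omega> \<in> space P. f (M A \<omega>) \<le> x} = exp (- (measure m A * x powr - \<alpha>))"
proof -
  define \<sigma> where "\<sigma> = measure m A powr (1 / \<alpha>)"
  have \<sigma>: "0 \<le> \<sigma>" "\<sigma> powr \<alpha> = measure m A" using alpha_pos by (auto simp: \<sigma>_def powr_powr)
  obtain N where N: "frechet_law \<alpha> 1 N"
    "distr P borel (M A) = distr (N \<Otimes>\<^sub>M \<kappa>) borel (\<lambda>(z, \<theta>). (\<sigma> * z) *\<^sub>R \<theta>)"
    using law[OF A] unfolding has_implicit_frechet_law_def \<sigma>_def by blast
  interpret N: real_distribution N using N(1) by (simp add: frechet_law_def)
  interpret N\<kappa>: pair_prob_space N \<kappa> ..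
  have [measurable]: "(\<lambda>\<theta>. \<theta>) \<in> borel_measurable \<kappa>"
    by (subst measurable_cong_sets[OF sets_kappa refl], rule measurable_restrict_space1) simp
  have "P.prob {\<omega> \<in> space P. f (M A \<omega>) \<le> x} = measure (distr P borel (M A)) {v. f v \<le> x}"
    using A by (subst measure_distr) (auto intro!: arg_cong[where f = P.prob])
  also have "\<dots> = measure (N \<Otimes>\<^sub>M \<kappa>) {p \<in> space (N \<Otimes>\<^sub>M \<kappa>). f ((\<sigma> * fst p) *\<^sub>R snd p) \<le> x}"
    unfolding N(2) by (subst measure_distr)
      (auto simp: case_prod_beta intro!: arg_cong[where f = "measure (N \<Otimes>\<^sub>M \<kappa>)"])
  also have "\<dots> = measure (N \<Otimes>\<^sub>M \<kappa>) ({z. \<sigma> * z \<le> x} \<times> space \<kappa>)"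
  proof (rule measure_eq_AE)
    have "AE p in N \<Otimes>\<^sub>M \<kappa>. 0 \<le> fst p"
    proof (rule AE_I')
      have "emeasure (N \<Otimes>\<^sub>M \<kappa>) ({..<0} \<times> space \<kappa>) = 0"
        using frechet_law_negative_null[OF N(1)] by (subst \<kappa>.emeasure_pair_measure_Times) auto
      then show "{..<0} \<times> space \<kappa> \<in> null_sets (N \<Otimes>\<^sub>M \<kappa>)" by (auto intro!: null_setsI)
    qed (auto simp: space_pair_measure)
    with AE_space show "AE p in N \<Otimes>\<^sub>M \<kappa>. p \<in> {p \<in> space (N \<Otimes>\<^sub>M \<kappa>). f ((\<sigma> * fst p) *\<^sub>R snd p) \<le> x}
        \<longleftrightarrow> p \<in> {z. \<sigma> * z \<le> x} \<times> space \<kappa>"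
    proof eventually_elim
      case (elim p)
      then have "f ((\<sigma> * fst p) *\<^sub>R snd p) = \<sigma> * fst p"
        using homogeneous[of "\<sigma> * fst p" "snd p"] \<sigma> by (auto simp: space_pair_measure space_kappa)
      then show ?case using elim by (auto simp: space_pair_measure)
    qed
  qed measurable
  also have "\<dots> = measure N {z. \<sigma> * z \<le> x}"
    by (simp add: measure_def \<kappa>.emeasure_pair_measure_Times \<kappa>.emeasure_space_1)
  also have "\<dots> = exp (- (measure m A * x powr - \<alpha>))"
  proof (cases "\<sigma> = 0")
    case True
    then have "measure m A = 0" using \<sigma> by simp
    then show ?thesis using True x N.prob_space by simp
  next
    case False
    then have "{z. \<sigma> * z \<le> x} = {..x / \<sigma>}" using \<sigma> by (auto simp: field_simps)
    moreover have "measure N {..x / \<sigma>} = exp (- ((x / \<sigma>) powr - \<alpha>))"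
      using N(1) False \<sigma> x by (simp add: frechet_law_def cdf_def)
    moreover have "(x / \<sigma>) powr - \<alpha> = measure m A * x powr - \<alpha>"
      using \<sigma> x False by (simp add: powr_divide powr_minus field_simps)
    ultimately show ?thesis by simp
  qed
  finally show ?thesis .
qed

lemma M_empty: "AE \<omega> in P. M {} \<omega> = 0"
proof -
  have "AE \<omega> in P. f (M {} \<omega>) \<le> 1 / real (Suc n)" for n
  proof -
    have "P.prob {\<omega> \<in> space P. f (M {} \<omega>) \<le> 1 / real (Suc n)} = 1" by (subst prob_f_M_le) auto
    then show ?thesis using P.prob_Collect_eq_1 by auto
  qed
  then have "AE \<omega> in P. \<forall>n. f (M {} \<omega>) \<le> 1 / real (Suc n)" by (simp add: AE_all_countable)
  then show ?thesis
  proof eventually_elim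
    case (elim \<omega>)
    have "f (M {} \<omega>) \<le> 0"
    proof (rule field_le_epsilon)
      fix e :: real assume "0 < e"
      then obtain n where "inverse (real (Suc n)) < e" using reals_Archimedean by blast
      then show "f (M {} \<omega>) \<le> 0 + e" using elim[rule_format, of n] by (simp add: inverse_eq_divide)
    qed
    then show ?case using nonneg[of "M {} \<omega>"] eq_0_iff by (simp add: antisym)
  qed
qed

end

text \<open>Being a vector of largest loss in \<open>V\<close>, as a relation: when losses tie, the operation \<open>f_max\<close> depends
on the order of its arguments, whereas this relation depends on the set alone and is stable under
regrouping.\<close>

definition is_f_max :: "('v \<Rightarrow> real) \<Rightarrow> 'v set \<Rightarrow> 'v \<Rightarrow> bool" where
  "is_f_max f V v \<longleftrightarrow> v \<in> V \<and> (\<forall>w\<in>V. f w \<le> f v)"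

lemma is_f_max_f_Max: "is_f_max f (x ` {..n}) (f_Max f x n)"
proof (induction n)
  case (Suc n)
  then show ?case by (auto simp: is_f_max_def f_max_def atMost_Suc intro: order_trans dest: bspec)
qed (simp add: is_f_max_def)

text \<open>Associativity of the maximum in relational form.\<close>

lemma is_f_max_UN:
  assumes "is_f_max f (x ` I) v" and "\<And>i. i \<in> I \<Longrightarrow> is_f_max f (W i) (x i)"
  shows "is_f_max f (\<Union>i\<in>I. W i) v"
proof -
  obtain i where i: "i \<in> I" "v = x i" using assms(1) by (auto simp: is_f_max_def)
  have "f w \<le> f v" if "j \<in> I" "w \<in> W j" for j w
    using assms(2)[OF that(1)] assms(1) that by (auto simp: is_f_max_def intro: order_trans[of _ "f (x j)"])
  then show ?thesis using assms(2)[OF i(1)] i by (auto simp: is_f_max_def)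
qed

context loss_function
begin

lemma is_f_max_scaleR:
  assumes "is_f_max f V v" "0 \<le> c"
  shows "is_f_max f ((*\<^sub>R) c ` V) (c *\<^sub>R v)"
  using assms by (auto simp: is_f_max_def homogeneous intro: mult_left_mono)

lemma f_Max_zero_padded:
  assumes "\<And>j. n < j \<Longrightarrow> x j = 0" and "n \<le> k"
  shows "f_Max f x k = f_Max f x n"
  using assms(2)
proof (induction k rule: dec_induct)
  case (step k)
  then show ?case using assms(1)[of "Suc k"] nonneg by (simp add: f_max_def)
qed simp

end

context implicit_frechet_sup_measure
begin

text \<open>The infinite additivity axiom applied to a sequence padded with empty sets. Almost surely
\<open>M {} = 0\<close>, so the maxima are eventually constant.\<close>

lemma M_finite_Union:
  assumes B: "\<And>j. j \<le> (n::nat) \<Longrightarrow> B j \<in> fmeasurable m" and disj: "disjoint_family_on B {..n}"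
  shows "AE \<omega> in P. is_f_max f ((\<lambda>j. M (B j) \<omega>) ` {..n}) (M (\<Union>j\<le>n. B j) \<omega>)"
proof -
  define D where "D j = (if j \<le> n then B j else {})" for j
  have U: "(\<Union>j. D j) = (\<Union>j\<le>n. B j)" by (auto simp: D_def split: if_splits)
  have "(\<Union>j\<le>n. B j) \<in> fmeasurable m" using B by (intro fmeasurable.finite_UN) auto
  moreover have "disjoint_family D" using disj by (auto simp: D_def disjoint_family_on_def)
  ultimately obtain J where "AE \<omega> in P. (\<lambda>k. f_Max f (\<lambda>j. M (D j) \<omega>) k) \<longlonglongrightarrow> M (\<Union>j. D j) \<omega> \<and>
      M (\<Union>j. D j) \<omega> = M (D (J \<omega>)) \<omega>"
    using RM2[of D] B U unfolding D_def by (metis (no_types, lifting) fmeasurable.empty_sets)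
  with M_empty show ?thesis
  proof eventually_elim
    case (elim \<omega>)
    have "\<forall>\<^sub>F k in sequentially. f_Max f (\<lambda>j. M (D j) \<omega>) k = f_Max f (\<lambda>j. M (D j) \<omega>) n"
      using elim by (intro eventually_sequentiallyI[of n] f_Max_zero_padded) (auto simp: D_def)
    then have "(\<lambda>k. f_Max f (\<lambda>j. M (D j) \<omega>) k) \<longlonglongrightarrow> f_Max f (\<lambda>j. M (D j) \<omega>) n"
      by (rule tendsto_eventually)
    with elim have "M (\<Union>j. D j) \<omega> = f_Max f (\<lambda>j. M (D j) \<omega>) n" using LIMSEQ_unique by blast
    moreover have "(\<lambda>j. M (D j) \<omega>) ` {..n} = (\<lambda>j. M (B j) \<omega>) ` {..n}" by (auto simp: D_def)
    ultimately show ?case using is_f_max_f_Max[of f "\<lambda>j. M (D j) \<omega>" n] U by simp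
  qed
qed

text \<open>Independence is postulated for families indexed by an initial segment of the naturals; an
enumeration transfers the product formula to any finite index set.\<close>

lemma prob_finite_family:
  assumes K: "finite K" and C: "\<And>k. k \<in> K \<Longrightarrow> C k \<in> fmeasurable m" and disj: "disjoint_family_on C K"
    and A: "\<And>k. k \<in> K \<Longrightarrow> A k \<in> sets borel"
  shows "P.prob {\<omega> \<in> space P. \<forall>k\<in>K. M (C k) \<omega> \<in> A k} = (\<Prod>k\<in>K. P.prob {\<omega> \<in> space P. M (C k) \<omega> \<in> A k})"
proof (cases "K = {}")
  case True
  then show ?thesis by (simp add: P.prob_space)
next
  case False
  obtain h where h: "bij_betw h {..<card K} K" using ex_bij_betw_nat_finite[OF K] by (auto simp: lessThan_atLeast0)
  have hK: "h ` {..<card K} = K" and inj: "inj_on h {..<card K}" using h by (auto simp: bij_betw_def)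
  have "disjoint_family_on (\<lambda>i. C (h i)) {..<card K}"
    unfolding disjoint_family_on_def
  proof (intro ballI impI)
    fix i j assume ij: "i \<in> {..<card K}" "j \<in> {..<card K}" "i \<noteq> j"
    then have "h i \<noteq> h j" "h i \<in> K" "h j \<in> K" using hK inj by (auto dest: inj_onD)
    then show "C (h i) \<inter> C (h j) = {}" using disj by (auto simp: disjoint_family_on_def)
  qed
  then have ind: "P.indep_vars (\<lambda>_. borel) (\<lambda>i. M (C (h i))) {..<card K}"
    using C hK by (intro RM1) auto
  have "{\<omega> \<in> space P. \<forall>k\<in>K. M (C k) \<omega> \<in> A k} = (\<Inter>i\<in>{..<card K}. M (C (h i)) -` A (h i) \<inter> space P)"
  proof -
    have "card K \<noteq> 0" using False K by simp
    moreover have "(\<forall>k\<in>K. Q k) \<longleftrightarrow> (\<forall>i\<in>{..<card K}. Q (h i))" for Q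
      using hK by (metis (no_types, lifting) imageE imageI)
    ultimately show ?thesis by auto
  qed
  also have "P.prob \<dots> = (\<Prod>i\<in>{..<card K}. P.prob (M (C (h i)) -` A (h i) \<inter> space P))"
  proof (rule P.indep_varsD[OF ind])
    show "{..<card K} \<noteq> {}" using K False by (simp add: lessThan_empty_iff)
    show "A (h i) \<in> sets borel" if "i \<in> {..<card K}" for i using that A hK by blast
  qed auto
  also have "\<dots> = (\<Prod>k\<in>K. P.prob (M (C k) -` A k \<inter> space P))"
    by (rule prod.reindex_bij_betw[OF h])
  also have "\<dots> = (\<Prod>k\<in>K. P.prob {\<omega> \<in> space P. M (C k) \<omega> \<in> A k})"
    by (intro prod.cong refl arg_cong[where f = P.prob]) auto
  finally show ?thesis .
qed

end

section \<open>A quantitative coupling on finitely many disjoint sets\<close>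

lemma exp_minus_diff_le:
  fixes p q :: real
  assumes "0 \<le> p" "p \<le> q"
  shows "exp (- p) - exp (- q) \<le> q - p"
proof -
  have "exp (- p) - exp (- q) = exp (- p) * (1 - exp (- (q - p)))"
    by (simp add: algebra_simps exp_add[symmetric] flip: exp_add)
  also have "\<dots> \<le> 1 * (1 - exp (- (q - p)))" using assms by (intro mult_right_mono) auto
  also have "\<dots> \<le> q - p" using exp_ge_add_one_self[of "- (q - p)"] unfolding mult_1 by linarith
  finally show ?thesis .
qed

text \<open>A grid that is fine both in the variable \<open>t\<close> and in \<open>t powr - \<alpha>\<close>. Equidistant points will do, by
uniform continuity on a compact interval away from \<open>0\<close>.\<close>

lemma powr_grid_exists:
  fixes \<alpha> s T \<eta> :: real
  assumes "0 < s" "s \<le> T" "0 < \<eta>"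
  obtains t :: "nat \<Rightarrow> real" and n where "t 0 = s" "t n = T" "incseq t"
    "\<And>l. t (Suc l) - t l \<le> \<eta>" "\<And>l. l < n \<Longrightarrow> t l powr - \<alpha> - t (Suc l) powr - \<alpha> \<le> \<eta>"
proof -
  have "continuous_on {s..T} (\<lambda>t. t powr - \<alpha>)"
    using assms by (intro continuous_intros) auto
  then have "uniformly_continuous_on {s..T} (\<lambda>t. t powr - \<alpha>)"
    by (intro compact_uniformly_continuous) auto
  then obtain d where d: "0 < d"
    "\<And>x y. x \<in> {s..T} \<Longrightarrow> y \<in> {s..T} \<Longrightarrow> dist y x < d \<Longrightarrow> dist (y powr - \<alpha>) (x powr - \<alpha>) < \<eta>"
    unfolding uniformly_continuous_on_def using assms by metis
  obtain n where n: "(T - s) / min \<eta> d < real n" using reals_Archimedean2 by blast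
  have n0: "0 < n"
    using n assms d by (cases n) (auto simp: divide_less_0_iff not_less split: if_splits)
  define h where "h = (T - s) / real n"
  have "T - s < real n * min \<eta> d" using n assms d by (simp add: pos_divide_less_eq)
  then have "h < min \<eta> d" using n0 by (simp add: h_def pos_divide_less_eq mult.commute del: min_less_iff_conj)
  then have h: "0 \<le> h" "h < \<eta>" "h < d" "real n * h = T - s"
    using n0 assms by (auto simp: h_def)
  define t where "t l = s + real l * h" for l
  show thesis
  proof
    show "t 0 = s" "t n = T" using h by (auto simp: t_def)
    show "incseq t" using h by (auto simp: t_def incseq_def mult_right_mono)
    show "t (Suc l) - t l \<le> \<eta>" for l using h by (simp add: t_def algebra_simps)
    fix l assume l: "l < n"
    have "real l * h \<le> real n * h" "real (Suc l) * h \<le> real n * h"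
      using l h by (intro mult_right_mono; simp)+
    then have "t l \<in> {s..T}" "t (Suc l) \<in> {s..T}"
      using h by (auto simp: t_def)
    moreover have "dist (t l) (t (Suc l)) < d"
      using h by (simp add: t_def dist_real_def algebra_simps)
    ultimately show "t l powr - \<alpha> - t (Suc l) powr - \<alpha> \<le> \<eta>"
      using d(2)[of "t (Suc l)" "t l"] by (simp add: dist_real_def)
  qed
qed

context loss_function
begin

lemma f_max_le_iff:
  assumes "is_f_max f ((\<lambda>k. c k *\<^sub>R v k) ` K) x" "\<And>k. k \<in> K \<Longrightarrow> 0 \<le> c k"
  shows "f x \<le> s \<longleftrightarrow> (\<forall>k\<in>K. c k * f (v k) \<le> s)"
proof -
  have "f x \<le> s \<longleftrightarrow> (\<forall>k\<in>K. f (c k *\<^sub>R v k) \<le> s)"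
    using assms(1) by (auto simp: is_f_max_def intro: order_trans)
  then show ?thesis using assms(2) by (simp add: homogeneous)
qed

text \<open>The deterministic core of the coupling. The vectors \<open>x\<close> and \<open>y\<close> are maxima of two rescalings of the
same vectors \<open>v k\<close>. Below the lowest level both are small. Otherwise their losses share a cell, and by
\<open>single\<close> that cell contains only one loss of the vectors rescaled by \<open>max (c k) (d k)\<close>; hence both
maxima are attained at the same index, so that \<open>x\<close> and \<open>y\<close> are multiples of one vector.\<close>

lemma dist_f_max_le:
  assumes L: "0 \<le> L" "\<And>v. norm v \<le> L * f v"
    and grid: "\<And>l. l < n \<Longrightarrow> t (Suc l) - t l \<le> \<delta>" "2 * t 0 \<le> \<delta>"
    and cd: "\<And>k. k \<in> K \<Longrightarrow> 0 \<le> c k" "\<And>k. k \<in> K \<Longrightarrow> 0 \<le> d k"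
    and x: "is_f_max f ((\<lambda>k. c k *\<^sub>R v k) ` K) x"
    and y: "is_f_max f ((\<lambda>k. d k *\<^sub>R v k) ` K) y"
    and same: "\<And>l. l \<le> n \<Longrightarrow> f x \<le> t l \<longleftrightarrow> f y \<le> t l"
    and top: "f x \<le> t n"
    and single: "\<And>l i j. l < n \<Longrightarrow> i \<in> K \<Longrightarrow> j \<in> K \<Longrightarrow>
        max (c i) (d i) * f (v i) \<in> {t l<..t (Suc l)} \<Longrightarrow> max (c j) (d j) * f (v j) \<in> {t l<..t (Suc l)} \<Longrightarrow> i = j"
  shows "dist x y \<le> L * \<delta>"
proof (cases "f x \<le> t 0")
  case True
  then have "f y \<le> t 0" using same[of 0] by simp
  have "dist x y \<le> norm x + norm y" by (simp add: dist_norm norm_triangle_ineq4)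
  also have "\<dots> \<le> L * f x + L * f y" using L by (intro add_mono) auto
  also have "\<dots> \<le> L * t 0 + L * t 0" using True \<open>f y \<le> t 0\<close> L by (intro add_mono mult_left_mono) auto
  also have "\<dots> = L * (2 * t 0)" by simp
  also have "\<dots> \<le> L * \<delta>" using L grid by (intro mult_left_mono) auto
  finally show ?thesis .
next
  case False
  then obtain l where l: "l < n" "\<not> f x \<le> t l" "f x \<le> t (Suc l)"
    using ex_least_nat_less[of "\<lambda>l. f x \<le> t l" n] top by blast
  then have fx: "f x \<in> {t l<..t (Suc l)}" and fy: "f y \<in> {t l<..t (Suc l)}"
    using same[of l] same[of "Suc l"] by auto
  obtain i j where i: "i \<in> K" "x = c i *\<^sub>R v i" and j: "j \<in> K" "y = d j *\<^sub>R v j"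
    using x y by (auto simp: is_f_max_def)
  have cle: "c k * f (v k) \<le> f x" if "k \<in> K" for k using f_max_le_iff[OF x cd(1), of "f x"] that by auto
  have dle: "d k * f (v k) \<le> f y" if "k \<in> K" for k using f_max_le_iff[OF y cd(2), of "f y"] that by auto
  have fx_eq: "f x = c i * f (v i)" and fy_eq: "f y = d j * f (v j)"
    using i j cd by (auto simp: homogeneous)
  have mx: "max (c k) (d k) * f (v k) = max (c k * f (v k)) (d k * f (v k))" for k
    using nonneg[of "v k"] by (auto simp: max_def mult_right_mono antisym)
  have "max (c i) (d i) * f (v i) \<in> {t l<..t (Suc l)}" "max (c j) (d j) * f (v j) \<in> {t l<..t (Suc l)}"
    using fx fy cle[OF j(1)] dle[OF i(1)] unfolding mx fx_eq fy_eq by auto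
  then have ij: "i = j" using single l(1) i(1) j(1) by blast
  have "dist x y = \<bar>c i - d i\<bar> * norm (v i)"
    using i j ij by (simp add: dist_norm flip: scaleR_left_diff_distrib)
  also have "\<dots> \<le> \<bar>c i - d i\<bar> * (L * f (v i))" using L by (intro mult_left_mono) auto
  also have "\<dots> = L * \<bar>(c i - d i) * f (v i)\<bar>" using nonneg[of "v i"] by (simp add: abs_mult)
  also have "\<dots> = L * \<bar>f x - f y\<bar>" using fx_eq fy_eq ij by (simp add: algebra_simps)
  also have "\<dots> \<le> L * \<delta>" using L grid(1)[OF l(1)] fx fy by (intro mult_left_mono) auto
  finally show ?thesis .
qed

end

text \<open>A finite disjoint family of sets over which simple functions are written; a coefficient family
\<open>c\<close> on \<open>K\<close> stands for the function with value \<open>c k\<close> on \<open>C k\<close>.\<close>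

locale implicit_frechet_atoms = implicit_frechet_sup_measure f \<alpha> \<kappa> m P M
  for f :: "real ^ 'd \<Rightarrow> real" and \<alpha> \<kappa> and m :: "'e measure" and P :: "'w measure" and M +
  fixes K :: "'i set" and C :: "'i \<Rightarrow> 'e set"
  assumes finite_K: "finite K"
    and C_fmeasurable: "k \<in> K \<Longrightarrow> C k \<in> fmeasurable m"
    and disjoint_C: "disjoint_family_on C K"
begin

lemma M_C_measurable[measurable]: "k \<in> K \<Longrightarrow> M (C k) \<in> borel_measurable P"
  using C_fmeasurable by (rule random_vector)

definition mass :: "('i \<Rightarrow> real) \<Rightarrow> real" where
  "mass w = (\<Sum>k\<in>K. w k * measure m (C k))"

lemma mass_nonneg: "(\<And>k. k \<in> K \<Longrightarrow> 0 \<le> w k) \<Longrightarrow> 0 \<le> mass w"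
  by (auto simp: mass_def intro!: sum_nonneg)

lemma mass_mono: "(\<And>k. k \<in> K \<Longrightarrow> v k \<le> w k) \<Longrightarrow> mass v \<le> mass w"
  by (auto simp: mass_def intro!: sum_mono mult_right_mono)

lemma has_bochner_integral_atoms:
  assumes "\<And>k x. k \<in> K \<Longrightarrow> x \<in> C k \<Longrightarrow> \<phi> x = w k" "\<And>x. x \<in> space m \<Longrightarrow> x \<notin> (\<Union>k\<in>K. C k) \<Longrightarrow> \<phi> x = 0"
  shows "has_bochner_integral m \<phi> (mass w)"
proof -
  have "has_bochner_integral m (\<lambda>x. \<Sum>k\<in>K. w k * indicator (C k) x) (mass w)"
    unfolding mass_def
  proof (intro has_bochner_integral_sum has_bochner_integral_mult_right)
    fix k assume "k \<in> K"
    then show "has_bochner_integral m (indicator (C k)) (measure m (C k))"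
      using C_fmeasurable by (intro has_bochner_integral_real_indicator) (auto simp: fmeasurable_def)
  qed
  moreover have "\<phi> x = (\<Sum>k\<in>K. w k * indicator (C k) x)" if x: "x \<in> space m" for x
  proof (cases "x \<in> (\<Union>k\<in>K. C k)")
    case True
    then obtain k where k: "k \<in> K" "x \<in> C k" by blast
    have "x \<notin> C j" if "j \<in> K - {k}" for j
      using that k disjoint_C by (auto simp: disjoint_family_on_def)
    then have "(\<Sum>j\<in>K. w j * indicator (C j) x) = w k * indicator (C k) x"
      using finite_K k(1) by (subst sum.remove[of K k]) (auto intro!: sum.neutral)
    then show ?thesis using assms(1)[OF k] k by simp
  next
    case False
    then show ?thesis using assms(2)[OF x] by (auto intro!: sum.neutral[symmetric])
  qed
  ultimately show ?thesis by (subst has_bochner_integral_cong[OF refl _ refl]) auto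
qed

lemma prob_scaled_le:
  assumes "k \<in> K" "0 \<le> a" "0 < x"
  shows "P.prob {\<omega> \<in> space P. a * f (M (C k) \<omega>) \<le> x} = exp (- (a powr \<alpha> * measure m (C k) * x powr - \<alpha>))"
proof (cases "a = 0")
  case True
  then show ?thesis using assms by (simp add: P.prob_space)
next
  case False
  then have "a * z \<le> x \<longleftrightarrow> z \<le> x / a" for z using assms by (simp add: field_simps)
  then show ?thesis
    using prob_f_M_le[OF C_fmeasurable[OF assms(1)], of "x / a"] False assms
    by (simp add: powr_divide powr_minus field_simps)
qed

lemma prob_all_le:
  assumes c: "\<And>k. k \<in> K \<Longrightarrow> 0 \<le> c k" and x: "0 < x"
  shows "P.prob {\<omega> \<in> space P. \<forall>k\<in>K. c k * f (M (C k) \<omega>) \<le> x} = exp (- (mass (\<lambda>k. c k powr \<alpha>) * x powr - \<alpha>))"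
proof -
  have "P.prob {\<omega> \<in> space P. \<forall>k\<in>K. c k * f (M (C k) \<omega>) \<le> x} =
      P.prob {\<omega> \<in> space P. \<forall>k\<in>K. M (C k) \<omega> \<in> {v. c k * f v \<le> x}}" by simp
  also have "\<dots> = (\<Prod>k\<in>K. P.prob {\<omega> \<in> space P. M (C k) \<omega> \<in> {v. c k * f v \<le> x}})"
    using finite_K C_fmeasurable disjoint_C by (intro prob_finite_family) auto
  also have "\<dots> = (\<Prod>k\<in>K. exp (- (c k powr \<alpha> * measure m (C k) * x powr - \<alpha>)))"
    using c x by (intro prod.cong refl) (simp add: prob_scaled_le)
  also have "\<dots> = exp (- (mass (\<lambda>k. c k powr \<alpha>) * x powr - \<alpha>))"
    using finite_K by (simp add: exp_sum[symmetric] mass_def sum_distrib_right sum_negf)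
  finally show ?thesis .
qed

lemma prob_exceed_le:
  assumes c: "\<And>k. k \<in> K \<Longrightarrow> 0 \<le> c k" and x: "0 < x"
  shows "P.prob {\<omega> \<in> space P. \<not> (\<forall>k\<in>K. c k * f (M (C k) \<omega>) \<le> x)} \<le> mass (\<lambda>k. c k powr \<alpha>) * x powr - \<alpha>"
proof -
  let ?A = "{\<omega> \<in> space P. \<forall>k\<in>K. c k * f (M (C k) \<omega>) \<le> x}"
  have "?A \<in> P.events" using finite_K by measurable
  then have "P.prob (space P - ?A) = 1 - P.prob ?A" by (rule P.prob_compl)
  also have "space P - ?A = {\<omega> \<in> space P. \<not> (\<forall>k\<in>K. c k * f (M (C k) \<omega>) \<le> x)}" by blast
  finally show ?thesis
    using exp_ge_add_one_self[of "- (mass (\<lambda>k. c k powr \<alpha>) * x powr - \<alpha>)"] prob_all_le[OF c x] by simp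
qed

text \<open>The coefficientwise maximum \<open>u\<close> of \<open>c\<close> and \<open>d\<close> stays below \<open>x\<close> precisely if both do. A separating
level thus means that \<open>c\<close> or \<open>d\<close> stays below \<open>x\<close> while \<open>u\<close> does not. The two probabilities are
differences of exponentials, hence at most differences of masses, and these add up to the claim
because \<open>2 * max p q - p - q = \<bar>p - q\<bar>\<close>.\<close>

lemma prob_separated_le:
  assumes c: "\<And>k. k \<in> K \<Longrightarrow> 0 \<le> c k" and d: "\<And>k. k \<in> K \<Longrightarrow> 0 \<le> d k" and x: "0 < x"
  shows "P.prob {\<omega> \<in> space P. (\<forall>k\<in>K. c k * f (M (C k) \<omega>) \<le> x) \<noteq> (\<forall>k\<in>K. d k * f (M (C k) \<omega>) \<le> x)}
    \<le> mass (\<lambda>k. \<bar>c k powr \<alpha> - d k powr \<alpha>\<bar>) * x powr - \<alpha>"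
proof -
  let ?S = "\<lambda>c. {\<omega> \<in> space P. \<forall>k\<in>K. c k * f (M (C k) \<omega>) \<le> x}"
  let ?u = "\<lambda>k. max (c k) (d k)"
  have meas: "?S c \<in> P.events" for c using finite_K by measurable
  have u: "0 \<le> ?u k" if "k \<in> K" for k using c[OF that] by auto
  have mx: "?u k * f v \<le> x \<longleftrightarrow> c k * f v \<le> x \<and> d k * f v \<le> x" for k v
    using nonneg[of v] by (auto simp: max_def) (meson mult_right_mono order_trans nle_le)+
  have sub: "?S ?u \<subseteq> ?S c" "?S ?u \<subseteq> ?S d" by (auto simp: mx)
  have one: "P.prob (?S e - ?S ?u) \<le> (mass (\<lambda>k. ?u k powr \<alpha>) - mass (\<lambda>k. e k powr \<alpha>)) * x powr - \<alpha>"
    if e: "\<And>k. k \<in> K \<Longrightarrow> 0 \<le> e k" "\<And>k. k \<in> K \<Longrightarrow> e k \<le> ?u k" and es: "?S ?u \<subseteq> ?S e" for e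
  proof -
    have "P.prob (?S e - ?S ?u) = P.prob (?S e) - P.prob (?S ?u)"
      using meas es by (intro P.finite_measure_Diff) auto
    also have "\<dots> = exp (- (mass (\<lambda>k. e k powr \<alpha>) * x powr - \<alpha>)) - exp (- (mass (\<lambda>k. ?u k powr \<alpha>) * x powr - \<alpha>))"
      using prob_all_le[of e x] prob_all_le[of ?u x] e u x by simp
    also have "\<dots> \<le> mass (\<lambda>k. ?u k powr \<alpha>) * x powr - \<alpha> - mass (\<lambda>k. e k powr \<alpha>) * x powr - \<alpha>"
      using e alpha_pos by (intro exp_minus_diff_le mult_nonneg_nonneg mult_right_mono mass_nonneg mass_mono powr_mono2) auto
    finally show ?thesis by (simp add: algebra_simps)
  qed
  have "{\<omega> \<in> space P. (\<forall>k\<in>K. c k * f (M (C k) \<omega>) \<le> x) \<noteq> (\<forall>k\<in>K. d k * f (M (C k) \<omega>) \<le> x)}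
      \<subseteq> (?S c - ?S ?u) \<union> (?S d - ?S ?u)" using sub by auto
  then have "P.prob {\<omega> \<in> space P. (\<forall>k\<in>K. c k * f (M (C k) \<omega>) \<le> x) \<noteq> (\<forall>k\<in>K. d k * f (M (C k) \<omega>) \<le> x)}
      \<le> P.prob ((?S c - ?S ?u) \<union> (?S d - ?S ?u))"
    using meas by (intro P.finite_measure_mono) auto
  also have "\<dots> \<le> P.prob (?S c - ?S ?u) + P.prob (?S d - ?S ?u)"
    using meas by (intro measure_Un_le) auto
  also have "\<dots> \<le> (mass (\<lambda>k. ?u k powr \<alpha>) - mass (\<lambda>k. c k powr \<alpha>)) * x powr - \<alpha> +
      (mass (\<lambda>k. ?u k powr \<alpha>) - mass (\<lambda>k. d k powr \<alpha>)) * x powr - \<alpha>"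
    using sub c d by (intro add_mono one) auto
  also have "\<dots> = (2 * mass (\<lambda>k. ?u k powr \<alpha>) - mass (\<lambda>k. c k powr \<alpha>) - mass (\<lambda>k. d k powr \<alpha>)) * x powr - \<alpha>"
    by (simp add: algebra_simps)
  also have "2 * mass (\<lambda>k. ?u k powr \<alpha>) - mass (\<lambda>k. c k powr \<alpha>) - mass (\<lambda>k. d k powr \<alpha>) =
      mass (\<lambda>k. \<bar>c k powr \<alpha> - d k powr \<alpha>\<bar>)"
  proof -
    have "2 * ?u k powr \<alpha> - c k powr \<alpha> - d k powr \<alpha> = \<bar>c k powr \<alpha> - d k powr \<alpha>\<bar>" if "k \<in> K" for k
      using powr_mono2[of \<alpha> "c k" "d k"] powr_mono2[of \<alpha> "d k" "c k"] c[OF that] d[OF that] alpha_pos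
      by (auto simp: max_def)
    then have "(\<Sum>k\<in>K. (2 * ?u k powr \<alpha> - c k powr \<alpha> - d k powr \<alpha>) * measure m (C k)) =
        mass (\<lambda>k. \<bar>c k powr \<alpha> - d k powr \<alpha>\<bar>)" unfolding mass_def by (intro sum.cong) auto
    then show ?thesis by (simp add: mass_def sum_distrib_left sum_subtractf left_diff_distrib mult.assoc)
  qed
  finally show ?thesis .
qed

text \<open>By independence each pair contributes a product; summing over all pairs gives a square. The square is
what makes the contributions of many small cells negligible.\<close>

lemma prob_two_in_interval_le:
  assumes c: "\<And>k. k \<in> K \<Longrightarrow> 0 \<le> c k" and st: "0 < s" "s \<le> t"
  shows "P.prob {\<omega> \<in> space P. \<exists>i\<in>K. \<exists>j\<in>K. i \<noteq> j \<and>
      c i * f (M (C i) \<omega>) \<in> {s<..t} \<and> c j * f (M (C j) \<omega>) \<in> {s<..t}}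
    \<le> (mass (\<lambda>k. c k powr \<alpha>) * (s powr - \<alpha> - t powr - \<alpha>))\<^sup>2"
proof -
  let ?E = "\<lambda>k. {\<omega> \<in> space P. c k * f (M (C k) \<omega>) \<in> {s<..t}}"
  define q where "q k = c k powr \<alpha> * measure m (C k) * (s powr - \<alpha> - t powr - \<alpha>)" for k
  have st': "t powr - \<alpha> \<le> s powr - \<alpha>" using st alpha_pos by (intro powr_mono2') auto
  have q0: "0 \<le> q k" for k unfolding q_def using st' by (intro mult_nonneg_nonneg) auto
  have E: "?E k \<in> P.events" if "k \<in> K" for k using that by measurable
  have Eq: "P.prob (?E k) \<le> q k" if k: "k \<in> K" for k
  proof -
    have "?E k = {\<omega> \<in> space P. c k * f (M (C k) \<omega>) \<le> t} - {\<omega> \<in> space P. c k * f (M (C k) \<omega>) \<le> s}" by auto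
    also have "P.prob \<dots> = P.prob {\<omega> \<in> space P. c k * f (M (C k) \<omega>) \<le> t} - P.prob {\<omega> \<in> space P. c k * f (M (C k) \<omega>) \<le> s}"
      using st k by (intro P.finite_measure_Diff) auto
    also have "\<dots> = exp (- (c k powr \<alpha> * measure m (C k) * t powr - \<alpha>)) - exp (- (c k powr \<alpha> * measure m (C k) * s powr - \<alpha>))"
      using prob_scaled_le[OF k c[OF k]] st by simp
    also have "\<dots> \<le> c k powr \<alpha> * measure m (C k) * s powr - \<alpha> - c k powr \<alpha> * measure m (C k) * t powr - \<alpha>"
      using st' by (intro exp_minus_diff_le mult_nonneg_nonneg mult_left_mono) auto
    finally show ?thesis by (simp add: q_def algebra_simps)
  qed
  have pair: "P.prob (?E i \<inter> ?E j) \<le> q i * q j" if ij: "i \<in> K" "j \<in> K" "i \<noteq> j" for i j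
  proof -
    have "?E i \<inter> ?E j = {\<omega> \<in> space P. \<forall>k\<in>{i, j}. M (C k) \<omega> \<in> {v. c k * f v \<in> {s<..t}}}" by auto
    also have "P.prob \<dots> = (\<Prod>k\<in>{i, j}. P.prob {\<omega> \<in> space P. M (C k) \<omega> \<in> {v. c k * f v \<in> {s<..t}}})"
    proof (rule prob_finite_family)
      show "disjoint_family_on C {i, j}" using disjoint_C ij by (auto simp: disjoint_family_on_def)
    qed (use ij C_fmeasurable in auto)
    also have "\<dots> = P.prob (?E i) * P.prob (?E j)" using ij by simp
    also have "\<dots> \<le> q i * q j" using Eq ij q0 by (intro mult_mono) auto
    finally show ?thesis .
  qed
  let ?I = "{p \<in> K \<times> K. fst p \<noteq> snd p}"
  have "{\<omega> \<in> space P. \<exists>i\<in>K. \<exists>j\<in>K. i \<noteq> j \<and> c i * f (M (C i) \<omega>) \<in> {s<..t} \<and> c j * f (M (C j) \<omega>) \<in> {s<..t}}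
      = (\<Union>p\<in>?I. ?E (fst p) \<inter> ?E (snd p))" by fastforce
  also have "P.prob \<dots> \<le> (\<Sum>p\<in>?I. P.prob (?E (fst p) \<inter> ?E (snd p)))"
    using finite_K E by (intro P.finite_measure_subadditive_finite) auto
  also have "\<dots> \<le> (\<Sum>p\<in>?I. q (fst p) * q (snd p))"
    using pair by (intro sum_mono) auto
  also have "\<dots> \<le> (\<Sum>p\<in>K \<times> K. q (fst p) * q (snd p))"
    using finite_K q0 by (intro sum_mono2) auto
  also have "\<dots> = (\<Sum>k\<in>K. q k) * (\<Sum>k\<in>K. q k)"
    by (simp add: sum_product sum.cartesian_product case_prod_beta)
  also have "(\<Sum>k\<in>K. q k) = mass (\<lambda>k. c k powr \<alpha>) * (s powr - \<alpha> - t powr - \<alpha>)"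
    by (simp add: q_def mass_def sum_distrib_right)
  finally show ?thesis by (simp add: power2_eq_square)
qed

text \<open>The union bound over the ways in which the deterministic estimate can fail: a level separates the
two losses, a cell contains two losses, or the loss exceeds the top of the grid.\<close>

lemma prob_dist_f_max_le:
  assumes L: "0 \<le> L" "\<And>v. norm v \<le> L * f v"
    and t: "0 < t 0" "incseq t" "\<And>l. l < n \<Longrightarrow> t (Suc l) - t l \<le> \<delta>" "2 * t 0 \<le> \<delta>"
    and c: "\<And>k. k \<in> K \<Longrightarrow> 0 \<le> c k" and d: "\<And>k. k \<in> K \<Longrightarrow> 0 \<le> d k"
    and X: "AE \<omega> in P. is_f_max f ((\<lambda>k. c k *\<^sub>R M (C k) \<omega>) ` K) (X \<omega>)"
    and Y: "AE \<omega> in P. is_f_max f ((\<lambda>k. d k *\<^sub>R M (C k) \<omega>) ` K) (Y \<omega>)"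
  shows "P.prob {\<omega> \<in> space P. L * \<delta> < dist (X \<omega>) (Y \<omega>)} \<le>
      mass (\<lambda>k. \<bar>c k powr \<alpha> - d k powr \<alpha>\<bar>) * (\<Sum>l\<le>n. t l powr - \<alpha>)
      + (\<Sum>l<n. (mass (\<lambda>k. max (c k) (d k) powr \<alpha>) * (t l powr - \<alpha> - t (Suc l) powr - \<alpha>))\<^sup>2)
      + mass (\<lambda>k. c k powr \<alpha>) * t n powr - \<alpha>"
proof -
  let ?u = "\<lambda>k. max (c k) (d k)"
  have tpos: "0 < t l" for l using t(1,2) by (auto simp: incseq_def intro: less_le_trans)
  define S where "S l = {\<omega> \<in> space P. (\<forall>k\<in>K. c k * f (M (C k) \<omega>) \<le> t l) \<noteq> (\<forall>k\<in>K. d k * f (M (C k) \<omega>) \<le> t l)}" for l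
  define E where "E l = {\<omega> \<in> space P. \<exists>i\<in>K. \<exists>j\<in>K. i \<noteq> j \<and>
      ?u i * f (M (C i) \<omega>) \<in> {t l<..t (Suc l)} \<and> ?u j * f (M (C j) \<omega>) \<in> {t l<..t (Suc l)}}" for l
  define T where "T = {\<omega> \<in> space P. \<not> (\<forall>k\<in>K. c k * f (M (C k) \<omega>) \<le> t n)}"
  have meas: "S l \<in> P.events" "E l \<in> P.events" "T \<in> P.events" for l
    unfolding S_def E_def T_def using finite_K by measurable
  have "P.prob {\<omega> \<in> space P. L * \<delta> < dist (X \<omega>) (Y \<omega>)} \<le> P.prob ((\<Union>l\<in>{..n}. S l) \<union> (\<Union>l\<in>{..<n}. E l) \<union> T)"
  proof (rule P.finite_measure_mono_AE)
    show "AE \<omega> in P. \<omega> \<in> {\<omega> \<in> space P. L * \<delta> < dist (X \<omega>) (Y \<omega>)} \<longrightarrow> \<omega> \<in> (\<Union>l\<in>{..n}. S l) \<union> (\<Union>l\<in>{..<n}. E l) \<union> T"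
      using X Y
    proof eventually_elim
      case (elim \<omega>)
      show ?case
      proof (rule impI, rule ccontr)
        assume w: "\<omega> \<in> {\<omega> \<in> space P. L * \<delta> < dist (X \<omega>) (Y \<omega>)}"
          and neg: "\<omega> \<notin> (\<Union>l\<in>{..n}. S l) \<union> (\<Union>l\<in>{..<n}. E l) \<union> T"
        have "dist (X \<omega>) (Y \<omega>) \<le> L * \<delta>"
        proof (rule dist_f_max_le[OF L t(3,4) c d elim])
          fix l assume "l \<le> n"
          then have "\<omega> \<notin> S l" using neg by blast
          then show "f (X \<omega>) \<le> t l \<longleftrightarrow> f (Y \<omega>) \<le> t l"
            using f_max_le_iff[OF elim(1) c, of "t l"] f_max_le_iff[OF elim(2) d, of "t l"] w by (simp add: S_def)
        next
          have "\<omega> \<notin> T" using neg by blast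
          then show "f (X \<omega>) \<le> t n" using f_max_le_iff[OF elim(1) c, of "t n"] w by (simp add: T_def)
        next
          fix l i j
          assume "l < n" and *: "i \<in> K" "j \<in> K" "?u i * f (M (C i) \<omega>) \<in> {t l<..t (Suc l)}"
            "?u j * f (M (C j) \<omega>) \<in> {t l<..t (Suc l)}"
          then have "\<omega> \<notin> E l" using neg by blast
          then show "i = j" unfolding E_def using * w by blast
        qed
        then show False using w by simp
      qed
    qed
    show "(\<Union>l\<in>{..n}. S l) \<union> (\<Union>l\<in>{..<n}. E l) \<union> T \<in> P.events"
      using meas by (intro sets.Un sets.finite_UN) auto
  qed
  also have "\<dots> \<le> P.prob (\<Union>l\<in>{..n}. S l) + P.prob (\<Union>l\<in>{..<n}. E l) + P.prob T"
    using meas by (intro order_trans[OF measure_Un_le] add_mono order_refl measure_Un_le sets.Un sets.finite_UN) auto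
  also have "\<dots> \<le> (\<Sum>l\<le>n. P.prob (S l)) + (\<Sum>l<n. P.prob (E l)) + P.prob T"
    using meas by (intro add_mono order_refl P.finite_measure_subadditive_finite) auto
  also have "\<dots> \<le> (\<Sum>l\<le>n. mass (\<lambda>k. \<bar>c k powr \<alpha> - d k powr \<alpha>\<bar>) * t l powr - \<alpha>)
      + (\<Sum>l<n. (mass (\<lambda>k. max (c k) (d k) powr \<alpha>) * (t l powr - \<alpha> - t (Suc l) powr - \<alpha>))\<^sup>2)
      + mass (\<lambda>k. c k powr \<alpha>) * t n powr - \<alpha>"
    unfolding S_def E_def T_def using tpos t(2) c d
    by (intro add_mono sum_mono prob_separated_le prob_two_in_interval_le prob_exceed_le)
      (auto simp: incseq_SucD max_def)
  finally show ?thesis by (simp add: sum_distrib_left)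
qed

end

section \<open>The pseudometric given by the power integral\<close>

text \<open>The \<open>L1\<close> distance of the \<open>\<alpha>\<close>-th powers: convergence in this distance is what convergence of the
integrals in probability amounts to.\<close>

definition powr_dist :: "'e measure \<Rightarrow> real \<Rightarrow> ('e \<Rightarrow> real) \<Rightarrow> ('e \<Rightarrow> real) \<Rightarrow> real" where
  "powr_dist m \<alpha> g h = (\<integral>x. \<bar>g x powr \<alpha> - h x powr \<alpha>\<bar> \<partial>m)"

lemma Lp_plus_integrable:
  assumes "g \<in> Lp_plus m \<alpha>"
  shows "integrable m (\<lambda>x. g x powr \<alpha>)"
  using assms by (intro integrableI_nonneg) (auto simp: Lp_plus_def)

lemma Lp_plus_integrable_abs_diff:
  assumes "g \<in> Lp_plus m \<alpha>" "h \<in> Lp_plus m \<alpha>"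
  shows "integrable m (\<lambda>x. \<bar>g x powr \<alpha> - h x powr \<alpha>\<bar>)"
  using assms by (intro integrable_abs Bochner_Integration.integrable_diff Lp_plus_integrable)

lemma powr_dist_commute: "powr_dist m \<alpha> g h = powr_dist m \<alpha> h g"
  by (simp add: powr_dist_def abs_minus_commute)

lemma powr_dist_triangle:
  assumes "g \<in> Lp_plus m \<alpha>" "h \<in> Lp_plus m \<alpha>" "k \<in> Lp_plus m \<alpha>"
  shows "powr_dist m \<alpha> g k \<le> powr_dist m \<alpha> g h + powr_dist m \<alpha> h k"
proof -
  note [intro] = Lp_plus_integrable_abs_diff[OF assms(1,2)] Lp_plus_integrable_abs_diff[OF assms(2,3)]
    Lp_plus_integrable_abs_diff[OF assms(1,3)]
  have "powr_dist m \<alpha> g k \<le> (\<integral>x. \<bar>g x powr \<alpha> - h x powr \<alpha>\<bar> + \<bar>h x powr \<alpha> - k x powr \<alpha>\<bar> \<partial>m)"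
    unfolding powr_dist_def by (intro integral_mono Bochner_Integration.integrable_add) auto
  also have "\<dots> = powr_dist m \<alpha> g h + powr_dist m \<alpha> h k"
    unfolding powr_dist_def by (intro Bochner_Integration.integral_add) auto
  finally show ?thesis .
qed

lemma integral_powr_le_add_powr_dist:
  assumes "g \<in> Lp_plus m \<alpha>" "h \<in> Lp_plus m \<alpha>"
  shows "(\<integral>x. h x powr \<alpha> \<partial>m) \<le> (\<integral>x. g x powr \<alpha> \<partial>m) + powr_dist m \<alpha> g h"
proof -
  note int = Lp_plus_integrable[OF assms(1)] Lp_plus_integrable[OF assms(2)] Lp_plus_integrable_abs_diff[OF assms]
  have "(\<integral>x. h x powr \<alpha> \<partial>m) \<le> (\<integral>x. g x powr \<alpha> + \<bar>g x powr \<alpha> - h x powr \<alpha>\<bar> \<partial>m)"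
    using int by (intro integral_mono Bochner_Integration.integrable_add) auto
  also have "\<dots> = (\<integral>x. g x powr \<alpha> \<partial>m) + powr_dist m \<alpha> g h"
    unfolding powr_dist_def using int by (intro Bochner_Integration.integral_add) auto
  finally show ?thesis .
qed

text \<open>The integrated form of \<open>2 * max a b = a + b + \<bar>a - b\<bar>\<close>.\<close>

lemma integral_max_powr:
  assumes "g \<in> Lp_plus m \<alpha>" "h \<in> Lp_plus m \<alpha>"
  shows "2 * (\<integral>z. max (g z powr \<alpha>) (h z powr \<alpha>) \<partial>m) =
    (\<integral>z. g z powr \<alpha> \<partial>m) + (\<integral>z. h z powr \<alpha> \<partial>m) + powr_dist m \<alpha> g h"
proof -
  note int = Lp_plus_integrable[OF assms(1)] Lp_plus_integrable[OF assms(2)] Lp_plus_integrable_abs_diff[OF assms]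
  have "2 * (\<integral>z. max (g z powr \<alpha>) (h z powr \<alpha>) \<partial>m) = (\<integral>z. 2 * max (g z powr \<alpha>) (h z powr \<alpha>) \<partial>m)" by simp
  also have "\<dots> = (\<integral>z. (g z powr \<alpha> + h z powr \<alpha>) + \<bar>g z powr \<alpha> - h z powr \<alpha>\<bar> \<partial>m)"
    by (intro Bochner_Integration.integral_cong) (auto simp: max_def)
  also have "\<dots> = (\<integral>z. g z powr \<alpha> \<partial>m) + (\<integral>z. h z powr \<alpha> \<partial>m) + powr_dist m \<alpha> g h"
    unfolding powr_dist_def using int by simp
  finally show ?thesis .
qed

text \<open>Positive level sets of \<open>s\<close> have finite measure by Markov's inequality. The level set of \<open>0\<close> may have
infinite measure, so it is replaced by the empty set.\<close>

lemma simple_function_imp_simple_repr: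
  assumes s: "simple_function m s" "\<And>x. 0 \<le> s x"
    and le: "\<And>x. x \<in> space m \<Longrightarrow> s x \<le> g x" and g: "g \<in> Lp_plus m \<alpha>" and \<alpha>: "0 < \<alpha>"
  shows "\<exists>n a B. simple_repr m s n a B"
proof -
  define I where "I = insert 0 (s ` space m)"
  have I: "finite I" "0 \<in> I" "\<And>v. v \<in> I \<Longrightarrow> 0 \<le> v"
    using s by (auto simp: I_def simple_function_def)
  then obtain n where n: "card I = Suc n" by (metis card_gt_0_iff empty_iff gr0_conv_Suc)
  obtain e where e: "bij_betw e {..n} I"
    using ex_bij_betw_nat_finite[OF I(1)] n by (auto simp: atLeast0LessThan lessThan_Suc_atMost)
  define A where "A v = (if v = 0 then {} else s -` {v} \<inter> space m)" for v
  have A_sets: "A v \<in> sets m" for v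
    using s(1) by (auto simp: A_def intro: simple_functionD)
  have A: "A v \<in> fmeasurable m" if v: "v \<in> I" for v
  proof (rule fmeasurableI[OF A_sets])
    show "emeasure m (A v) < \<infinity>"
    proof (cases "v = 0")
      case False
      then have "0 < v" using I(3)[OF v] by simp
      have "ennreal (v powr \<alpha>) * emeasure m (A v) = (\<integral>\<^sup>+x. ennreal (v powr \<alpha>) * indicator (A v) x \<partial>m)"
        using A_sets by (simp add: nn_integral_cmult_indicator)
      also have "\<dots> \<le> (\<integral>\<^sup>+x. ennreal (g x powr \<alpha>) \<partial>m)"
      proof (rule nn_integral_mono)
        fix x assume x: "x \<in> space m"
        show "ennreal (v powr \<alpha>) * indicator (A v) x \<le> ennreal (g x powr \<alpha>)"
          using le[OF x] \<open>0 < v\<close> \<alpha> by (auto simp: A_def indicator_def intro!: ennreal_leI powr_mono2)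
      qed
      also have "\<dots> < \<infinity>" using g by (simp add: Lp_plus_def)
      finally show ?thesis using \<open>0 < v\<close> by (auto simp: ennreal_mult_less_top)
    qed (simp add: A_def)
  qed
  have "simple_repr m s n e (\<lambda>j. A (e j))"
    unfolding simple_repr_def
  proof (intro conjI allI impI ballI)
    fix j assume "j \<le> n"
    then have "e j \<in> I" using e by (auto simp: bij_betw_def)
    then show "0 \<le> e j" "A (e j) \<in> fmeasurable m" using I A by auto
  next
    show "disjoint_family_on (\<lambda>j. A (e j)) {..n}"
      unfolding disjoint_family_on_def
    proof (intro ballI impI)
      fix i j assume "i \<in> {..n}" "j \<in> {..n}" "i \<noteq> j"
      then have "e i \<noteq> e j" using e by (auto simp: bij_betw_def dest: inj_onD)
      then show "A (e i) \<inter> A (e j) = {}" by (auto simp: A_def)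
    qed
  next
    fix x assume x: "x \<in> space m"
    have "(\<Sum>j\<le>n. e j * indicator (A (e j)) x) = (\<Sum>v\<in>I. v * indicator (A v) x)"
      using sum.reindex_bij_betw[OF e, of "\<lambda>v. v * indicator (A v) x"] by simp
    also have "\<dots> = (\<Sum>v\<in>I. if v = s x then v else 0)"
      using x by (intro sum.cong) (auto simp: A_def indicator_def)
    also have "\<dots> = s x" using I(1) x by (simp add: I_def)
    finally show "s x = (\<Sum>j\<le>n. e j * indicator (A (e j)) x)" by simp
  qed
  then show ?thesis by blast
qed

lemma Lp_plus_simple_sequence:
  assumes g: "g \<in> Lp_plus m \<alpha>" and \<alpha>: "0 < \<alpha>"
  obtains h where "\<And>n. \<exists>N a B. simple_repr m (h n) N a B"
    "\<And>x. x \<in> space m \<Longrightarrow> incseq (\<lambda>n. h n x) \<and> (\<lambda>n. h n x) \<longlonglongrightarrow> g x"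
proof -
  define u where "u x = indicator (space m) x * g x" for x
  have "u \<in> borel_measurable m" "\<And>x. 0 \<le> u x"
    using g by (auto simp: u_def[abs_def] Lp_plus_def indicator_def)
  from borel_measurable_implies_simple_function_sequence_real[OF this]
  obtain h where h: "incseq h" "\<And>i. simple_function m (h i)" "\<And>x. bdd_above (range (\<lambda>i. h i x))"
    "\<And>i x. 0 \<le> h i x" "u = (SUP i. h i)" by blast
  have u: "u x = (SUP i. h i x)" for x by (simp add: h(5) image_image)
  have lim: "incseq (\<lambda>n. h n x) \<and> (\<lambda>n. h n x) \<longlonglongrightarrow> g x" if x: "x \<in> space m" for x
  proof -
    have "incseq (\<lambda>n. h n x)" using h(1) by (auto simp: incseq_def le_fun_def)
    moreover from LIMSEQ_incseq_SUP[OF h(3) this] have "(\<lambda>n. h n x) \<longlonglongrightarrow> u x" by (simp add: u)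
    ultimately show ?thesis using x by (simp add: u_def)
  qed
  show thesis
  proof (rule that)
    fix n
    have "h n x \<le> g x" if "x \<in> space m" for x using lim[OF that] incseq_le by blast
    then show "\<exists>N a B. simple_repr m (h n) N a B"
      using h g \<alpha> by (intro simple_function_imp_simple_repr) auto
  qed (rule lim)
qed

lemma powr_dist_monotone_approx:
  assumes g: "g \<in> Lp_plus m \<alpha>" and \<alpha>: "0 < \<alpha>" and h: "\<And>n. h n \<in> Lp_plus m \<alpha>"
    and mono: "\<And>x. x \<in> space m \<Longrightarrow> incseq (\<lambda>n. h n x) \<and> (\<lambda>n. h n x) \<longlonglongrightarrow> g x"
  shows "(\<lambda>n. powr_dist m \<alpha> (h n) g) \<longlonglongrightarrow> 0"
proof -
  have [measurable]: "g \<in> borel_measurable m" "\<And>n. h n \<in> borel_measurable m"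
    using g h by (auto simp: Lp_plus_def)
  have "(\<lambda>n. \<integral>x. \<bar>h n x powr \<alpha> - g x powr \<alpha>\<bar> \<partial>m) \<longlonglongrightarrow> (\<integral>x. 0 \<partial>m)"
  proof (rule integral_dominated_convergence[where w = "\<lambda>x. g x powr \<alpha>"])
    show "AE x in m. (\<lambda>n. \<bar>h n x powr \<alpha> - g x powr \<alpha>\<bar>) \<longlonglongrightarrow> 0"
    proof (rule AE_I2)
      fix x assume x: "x \<in> space m"
      have "\<And>n. 0 \<le> h n x" using h x by (auto simp: Lp_plus_def)
      then have "(\<lambda>n. h n x powr \<alpha>) \<longlonglongrightarrow> g x powr \<alpha>"
        using mono[OF x] \<alpha> by (intro tendsto_powr' tendsto_const) auto
      then show "(\<lambda>n. \<bar>h n x powr \<alpha> - g x powr \<alpha>\<bar>) \<longlonglongrightarrow> 0"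
        by (intro tendsto_rabs_zero) (simp add: LIM_zero)
    qed
    show "AE x in m. norm \<bar>h n x powr \<alpha> - g x powr \<alpha>\<bar> \<le> g x powr \<alpha>" for n
    proof (rule AE_I2)
      fix x assume x: "x \<in> space m"
      have "0 \<le> h n x" using h x by (auto simp: Lp_plus_def)
      moreover have "h n x \<le> g x" using mono[OF x] incseq_le by blast
      ultimately have "h n x powr \<alpha> \<le> g x powr \<alpha>" using \<alpha> by (intro powr_mono2) auto
      then show "norm \<bar>h n x powr \<alpha> - g x powr \<alpha>\<bar> \<le> g x powr \<alpha>" by simp
    qed
  qed (use Lp_plus_integrable[OF g] in auto)
  then show ?thesis by (simp add: powr_dist_def)
qed

section \<open>Integrals of simple functions\<close>

lemma simple_repr_value:
  assumes "simple_repr m g n a B"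
  shows "j \<le> n \<Longrightarrow> x \<in> B j \<Longrightarrow> g x = a j"
    and "x \<in> space m \<Longrightarrow> x \<notin> (\<Union>j\<le>n. B j) \<Longrightarrow> g x = 0"
proof -
  have g: "x \<in> space m \<Longrightarrow> g x = (\<Sum>j\<le>n. a j * indicator (B j) x)" for x
    using assms by (auto simp: simple_repr_def)
  show "g x = a j" if j: "j \<le> n" "x \<in> B j"
  proof -
    have "x \<in> space m" using j assms by (auto simp: simple_repr_def dest: fmeasurableD sets.sets_into_space)
    moreover have "x \<notin> B i" if "i \<in> {..n} - {j}" for i
      using that j assms by (auto simp: simple_repr_def disjoint_family_on_def)
    then have "(\<Sum>i\<le>n. a i * indicator (B i) x) = a j * indicator (B j) x"
      using j(1) by (subst sum.remove[of "{..n}" j]) (auto intro!: sum.neutral)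
    ultimately show ?thesis using g j by simp
  qed
  show "g x = 0" if "x \<in> space m" "x \<notin> (\<Union>j\<le>n. B j)"
    using g[OF that(1)] that(2) by (auto intro!: sum.neutral)
qed

context implicit_frechet_sup_measure
begin

lemma simple_integral_measurable:
  assumes "is_simple_integral f m M g X"
  shows "X \<in> borel_measurable P"
proof -
  obtain n a B where r: "simple_repr m g n a B" and X: "X = (\<lambda>\<omega>. f_Max f (\<lambda>j. a j *\<^sub>R M (B j) \<omega>) n)"
    using assms by (auto simp: is_simple_integral_def)
  have "(\<lambda>\<omega>. f_Max f (\<lambda>j. a j *\<^sub>R M (B j) \<omega>) k) \<in> borel_measurable P" if "k \<le> n" for k
    using that
  proof (induction k)
    case 0
    have [measurable]: "M (B 0) \<in> borel_measurable P" using r by (intro random_vector) (auto simp: simple_repr_def)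
    show ?case by simp
  next
    case (Suc k)
    then have [measurable]: "(\<lambda>\<omega>. f_Max f (\<lambda>j. a j *\<^sub>R M (B j) \<omega>) k) \<in> borel_measurable P" by simp
    have [measurable]: "M (B (Suc k)) \<in> borel_measurable P"
      using r Suc.prems by (intro random_vector) (auto simp: simple_repr_def)
    show ?case by (simp add: f_max_def)
  qed
  then show ?thesis using X by simp
qed

lemma simple_integral_Lp_plus:
  assumes "is_simple_integral f m M g X"
  shows "g \<in> Lp_plus m \<alpha>"
proof -
  obtain n a B where r: "simple_repr m g n a B" using assms by (auto simp: is_simple_integral_def)
  interpret atoms: implicit_frechet_atoms f \<alpha> \<kappa> m P M "{..n}" B
    using r by unfold_locales (auto simp: simple_repr_def)
  have "has_bochner_integral m g (atoms.mass a)"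
    using simple_repr_value[OF r] by (intro atoms.has_bochner_integral_atoms) auto
  then have "g \<in> borel_measurable m" by (auto dest: borel_measurable_has_bochner_integral)
  moreover have "0 \<le> g x" if x: "x \<in> space m" for x
    using r x by (auto simp: simple_repr_def intro!: sum_nonneg)
  moreover have "has_bochner_integral m (\<lambda>x. g x powr \<alpha>) (atoms.mass (\<lambda>j. a j powr \<alpha>))"
    using simple_repr_value[OF r] alpha_pos by (intro atoms.has_bochner_integral_atoms) auto
  then have "integrable m (\<lambda>x. g x powr \<alpha>)" by (rule integrable.intros)
  then have "(\<integral>\<^sup>+x. ennreal (g x powr \<alpha>) \<partial>m) < \<infinity>" by (simp add: nn_integral_eq_integral)
  ultimately show ?thesis by (simp add: Lp_plus_def)
qed

text \<open>Adding the missing part of \<open>U\<close> with coefficient \<open>0\<close> lets two representations cover the same set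
without changing the integral: \<open>0\<close> has the smallest loss.\<close>

lemma simple_repr_with_union:
  assumes r: "simple_repr m g n a B" and U: "U \<in> fmeasurable m" "(\<Union>j\<le>n. B j) \<subseteq> U"
  obtains a' B' where "simple_repr m g (Suc n) a' B'" "(\<Union>j\<le>Suc n. B' j) = U"
    "\<And>\<omega>. is_f_max f ((\<lambda>j. a' j *\<^sub>R M (B' j) \<omega>) ` {..Suc n}) (f_Max f (\<lambda>j. a j *\<^sub>R M (B j) \<omega>) n)"
proof -
  define a' where "a' j = (if j \<le> n then a j else 0)" for j
  define B' where "B' j = (if j \<le> n then B j else U - (\<Union>j\<le>n. B j))" for j
  have UB: "(\<Union>j\<le>n. B j) \<in> fmeasurable m" using r by (intro fmeasurable.finite_UN) (auto simp: simple_repr_def)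
  have disj: "disjoint_family_on B {..n}" using r by (simp add: simple_repr_def)
  show thesis
  proof
    show "simple_repr m g (Suc n) a' B'"
      unfolding simple_repr_def
    proof (intro conjI allI impI ballI)
      fix j show "0 \<le> a' j" "B' j \<in> fmeasurable m"
        if "j \<le> Suc n" using r U UB by (auto simp: a'_def B'_def simple_repr_def)
    next
      show "disjoint_family_on B' {..Suc n}"
        using disj unfolding disjoint_family_on_def B'_def by auto
    next
      fix x assume "x \<in> space m"
      then show "g x = (\<Sum>j\<le>Suc n. a' j * indicator (B' j) x)"
        using r by (simp add: simple_repr_def a'_def B'_def)
    qed
    show "(\<Union>j\<le>Suc n. B' j) = U"
      using U by (auto simp: B'_def atMost_Suc split: if_splits)
    show "is_f_max f ((\<lambda>j. a' j *\<^sub>R M (B' j) \<omega>) ` {..Suc n}) (f_Max f (\<lambda>j. a j *\<^sub>R M (B j) \<omega>) n)" for \<omega>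
    proof -
      have "(\<lambda>j. a' j *\<^sub>R M (B' j) \<omega>) ` {..Suc n} = insert 0 ((\<lambda>j. a j *\<^sub>R M (B j) \<omega>) ` {..n})"
        by (auto simp: a'_def B'_def atMost_Suc)
      then show ?thesis
        using is_f_max_f_Max[of f "\<lambda>j. a j *\<^sub>R M (B j) \<omega>" n] nonneg by (auto simp: is_f_max_def)
    qed
  qed
qed

lemma is_f_max_refine:
  fixes n p :: nat
  assumes B: "\<And>i. i \<le> n \<Longrightarrow> B i \<in> fmeasurable m" "\<And>i. i \<le> n \<Longrightarrow> 0 \<le> a i"
    and D: "\<And>j. j \<le> p \<Longrightarrow> D j \<in> fmeasurable m" "disjoint_family_on D {..p}"
    and sub: "\<And>i. i \<le> n \<Longrightarrow> B i \<subseteq> (\<Union>j\<le>p. D j)"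
    and X: "\<And>\<omega>. is_f_max f ((\<lambda>i. a i *\<^sub>R M (B i) \<omega>) ` {..n}) (X \<omega>)"
  shows "AE \<omega> in P. is_f_max f ((\<lambda>(i, j). a i *\<^sub>R M (B i \<inter> D j) \<omega>) ` ({..n} \<times> {..p})) (X \<omega>)"
proof -
  have "AE \<omega> in P. is_f_max f ((\<lambda>j. M (B i \<inter> D j) \<omega>) ` {..p}) (M (B i) \<omega>)" if i: "i \<in> {..n}" for i
  proof -
    have "(\<Union>j\<le>p. B i \<inter> D j) = B i" using sub[of i] i by auto
    moreover have "AE \<omega> in P. is_f_max f ((\<lambda>j. M (B i \<inter> D j) \<omega>) ` {..p}) (M (\<Union>j\<le>p. B i \<inter> D j) \<omega>)"
      using B(1) D(1) i disjoint_family_on_bisimulation[OF D(2), of "\<lambda>j. B i \<inter> D j"]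
      by (intro M_finite_Union[of p "\<lambda>j. B i \<inter> D j"]) auto
    ultimately show ?thesis by simp
  qed
  then have "AE \<omega> in P. \<forall>i\<in>{..n}. is_f_max f ((\<lambda>j. M (B i \<inter> D j) \<omega>) ` {..p}) (M (B i) \<omega>)"
    by (intro AE_finite_allI) auto
  then show ?thesis
  proof eventually_elim
    case (elim \<omega>)
    have "is_f_max f (\<Union>i\<in>{..n}. (*\<^sub>R) (a i) ` (\<lambda>j. M (B i \<inter> D j) \<omega>) ` {..p}) (X \<omega>)"
      using elim B(2) by (intro is_f_max_UN[OF X] is_f_max_scaleR) auto
    moreover have "(\<Union>i\<in>{..n}. (*\<^sub>R) (a i) ` (\<lambda>j. M (B i \<inter> D j) \<omega>) ` {..p}) =
        (\<lambda>(i, j). a i *\<^sub>R M (B i \<inter> D j) \<omega>) ` ({..n} \<times> {..p})" by force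
    ultimately show ?case by simp
  qed
qed

text \<open>The pairwise intersections of the sets of two representations, padded to a common union, serve both
functions. Almost surely both integrals are maxima over this common family; the exceptional null set
absorbs the use of additivity of \<open>M\<close>. For \<open>g = h\<close> this also covers the comparison of two
representations of one function.\<close>

lemma common_atoms:
  assumes "is_simple_integral f m M g X" "is_simple_integral f m M h Y"
  obtains K :: "(nat \<times> nat) set" and C c d where "implicit_frechet_atoms f \<alpha> \<kappa> m P M K C"
    "\<And>k. k \<in> K \<Longrightarrow> 0 \<le> c k" "\<And>k. k \<in> K \<Longrightarrow> 0 \<le> d k"
    "\<And>k x. k \<in> K \<Longrightarrow> x \<in> C k \<Longrightarrow> g x = c k" "\<And>k x. k \<in> K \<Longrightarrow> x \<in> C k \<Longrightarrow> h x = d k"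
    "\<And>x. x \<in> space m \<Longrightarrow> x \<notin> (\<Union>k\<in>K. C k) \<Longrightarrow> g x = 0"
    "\<And>x. x \<in> space m \<Longrightarrow> x \<notin> (\<Union>k\<in>K. C k) \<Longrightarrow> h x = 0"
    "AE \<omega> in P. is_f_max f ((\<lambda>k. c k *\<^sub>R M (C k) \<omega>) ` K) (X \<omega>)"
    "AE \<omega> in P. is_f_max f ((\<lambda>k. d k *\<^sub>R M (C k) \<omega>) ` K) (Y \<omega>)"
proof -
  obtain n0 a0 B0 where r0: "simple_repr m g n0 a0 B0" and X: "X = (\<lambda>\<omega>. f_Max f (\<lambda>j. a0 j *\<^sub>R M (B0 j) \<omega>) n0)"
    using assms by (auto simp: is_simple_integral_def)
  obtain p0 b0 D0 where s0: "simple_repr m h p0 b0 D0" and Y: "Y = (\<lambda>\<omega>. f_Max f (\<lambda>j. b0 j *\<^sub>R M (D0 j) \<omega>) p0)"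
    using assms by (auto simp: is_simple_integral_def)
  define U where "U = (\<Union>j\<le>n0. B0 j) \<union> (\<Union>j\<le>p0. D0 j)"
  have U: "U \<in> fmeasurable m"
    unfolding U_def using r0 s0 by (intro fmeasurable.Un fmeasurable.finite_UN) (auto simp: simple_repr_def)
  obtain a B where r: "simple_repr m g (Suc n0) a B" and BU: "(\<Union>j\<le>Suc n0. B j) = U"
    and BX: "\<And>\<omega>. is_f_max f ((\<lambda>j. a j *\<^sub>R M (B j) \<omega>) ` {..Suc n0}) (X \<omega>)"
    using simple_repr_with_union[OF r0 U] unfolding X U_def by blast
  obtain b D where s: "simple_repr m h (Suc p0) b D" and DU: "(\<Union>j\<le>Suc p0. D j) = U"
    and DY: "\<And>\<omega>. is_f_max f ((\<lambda>j. b j *\<^sub>R M (D j) \<omega>) ` {..Suc p0}) (Y \<omega>)"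
    using simple_repr_with_union[OF s0 U] unfolding Y U_def by blast
  define n where "n = Suc n0"
  define p where "p = Suc p0"
  note r = r[folded n_def] and BU = BU[folded n_def] and BX = BX[folded n_def]
  note s = s[folded p_def] and DU = DU[folded p_def] and DY = DY[folded p_def]
  have B: "\<And>i. i \<le> n \<Longrightarrow> B i \<in> fmeasurable m" "\<And>i. i \<le> n \<Longrightarrow> 0 \<le> a i" "disjoint_family_on B {..n}"
    using r by (auto simp: simple_repr_def)
  have D: "\<And>i. i \<le> p \<Longrightarrow> D i \<in> fmeasurable m" "\<And>i. i \<le> p \<Longrightarrow> 0 \<le> b i" "disjoint_family_on D {..p}"
    using s by (auto simp: simple_repr_def)
  have sub: "B i \<subseteq> (\<Union>j\<le>p. D j)" if "i \<le> n" for i using that BU DU by blast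
  have sub': "D i \<subseteq> (\<Union>j\<le>n. B j)" if "i \<le> p" for i using that BU DU by blast
  define K where "K = {..n} \<times> {..p}"
  define C where "C k = B (fst k) \<inter> D (snd k)" for k
  have UC: "(\<Union>k\<in>K. C k) = U"
  proof -
    have "(\<Union>k\<in>K. C k) = (\<Union>i\<le>n. B i) \<inter> (\<Union>j\<le>p. D j)" by (auto simp: K_def C_def)
    then show ?thesis using BU DU by simp
  qed
  show thesis
  proof (rule that[of K C "\<lambda>k. a (fst k)" "\<lambda>k. b (snd k)"])
    show "implicit_frechet_atoms f \<alpha> \<kappa> m P M K C"
    proof unfold_locales
      show "finite K" by (simp add: K_def)
      show "C k \<in> fmeasurable m" if "k \<in> K" for k using that B(1) D(1) by (auto simp: K_def C_def)
      show "disjoint_family_on C K" unfolding disjoint_family_on_def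
      proof (intro ballI impI)
        fix k l assume kl: "k \<in> K" "l \<in> K" "k \<noteq> l"
        show "C k \<inter> C l = {}"
        proof (cases "fst k = fst l")
          case True
          then have "D (snd k) \<inter> D (snd l) = {}"
            using kl by (intro disjoint_family_onD[OF D(3)]) (auto simp: K_def prod_eq_iff)
          then show ?thesis by (auto simp: C_def)
        next
          case False
          then have "B (fst k) \<inter> B (fst l) = {}"
            using kl by (intro disjoint_family_onD[OF B(3)]) (auto simp: K_def)
          then show ?thesis by (auto simp: C_def)
        qed
      qed
    qed
    show "0 \<le> a (fst k)" "0 \<le> b (snd k)" if "k \<in> K" for k using that B D by (auto simp: K_def)
    show "g x = a (fst k)" "h x = b (snd k)" if "k \<in> K" "x \<in> C k" for k x
      using that simple_repr_value(1)[OF r] simple_repr_value(1)[OF s] by (auto simp: K_def C_def)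
    show "g x = 0" "h x = 0" if "x \<in> space m" "x \<notin> (\<Union>k\<in>K. C k)" for x
      using that simple_repr_value(2)[OF r] simple_repr_value(2)[OF s] BU DU UC by auto
    show "AE \<omega> in P. is_f_max f ((\<lambda>k. a (fst k) *\<^sub>R M (C k) \<omega>) ` K) (X \<omega>)"
      using is_f_max_refine[OF B(1,2) D(1,3) sub BX] by (simp add: K_def C_def case_prod_beta)
    have "AE \<omega> in P. is_f_max f ((\<lambda>(i, j). b i *\<^sub>R M (D i \<inter> B j) \<omega>) ` ({..p} \<times> {..n})) (Y \<omega>)"
      using is_f_max_refine[OF D(1,2) B(1,3) sub' DY] .
    moreover have "(\<lambda>(i, j). b i *\<^sub>R M (D i \<inter> B j) \<omega>) ` ({..p} \<times> {..n}) = (\<lambda>k. b (snd k) *\<^sub>R M (C k) \<omega>) ` K" for \<omega>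
      unfolding K_def C_def by (subst product_swap[symmetric]) (auto simp: image_image case_prod_beta Int_commute)
    ultimately show "AE \<omega> in P. is_f_max f ((\<lambda>k. b (snd k) *\<^sub>R M (C k) \<omega>) ` K) (Y \<omega>)" by simp
  qed
qed

text \<open>The grid is chosen in terms of \<open>\<epsilon>\<close> and \<open>R\<close> alone, and \<open>\<delta>\<close> in terms of the grid, so that one \<open>\<delta>\<close> serves
all pairs of simple functions at once.\<close>

lemma simple_integral_dist_uniform:
  assumes \<epsilon>: "0 < \<epsilon>"
  obtains \<delta> where "0 < \<delta>"
    "\<And>g h X Y. is_simple_integral f m M g X \<Longrightarrow> is_simple_integral f m M h Y \<Longrightarrow>
      (\<integral>x. g x powr \<alpha> \<partial>m) \<le> R \<Longrightarrow> powr_dist m \<alpha> g h \<le> \<delta> \<Longrightarrow>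
      P.prob {\<omega> \<in> space P. \<epsilon> < dist (X \<omega>) (Y \<omega>)} \<le> \<epsilon>"
proof -
  obtain L where L: "0 < L" "\<And>v. norm v \<le> L * f v" using norm_le_f by blast
  define R' where "R' = \<bar>R\<bar> + 1"
  have R': "1 \<le> R'" "R + 1 \<le> R'" by (auto simp: R'_def)
  \<comment> \<open>The lowest level \<open>s\<close> controls the distance of two vectors below the grid, the highest level \<open>T\<close> the
    probability of exceeding the grid, and the mesh \<open>\<eta>\<close> both the distance within a cell and the
    probability of two losses in one cell. The constant \<open>R'\<close> bounds the masses that occur, including
    that of the maximum of the two functions.\<close>
  define s where "s = \<epsilon> / (2 * L)"
  have s: "0 < s" "2 * s \<le> \<epsilon> / L" using L \<epsilon> by (auto simp: s_def)
  define T where "T = max s ((3 * R' / \<epsilon>) powr (1 / \<alpha>))"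
  have T: "s \<le> T" "R' * T powr - \<alpha> \<le> \<epsilon> / 3"
  proof -
    have "T powr - \<alpha> \<le> ((3 * R' / \<epsilon>) powr (1 / \<alpha>)) powr - \<alpha>"
      using \<epsilon> R' alpha_pos by (intro powr_mono2') (auto simp: T_def)
    also have "\<dots> = \<epsilon> / (3 * R')" using \<epsilon> R' alpha_pos by (simp add: powr_powr powr_minus field_simps)
    finally show "R' * T powr - \<alpha> \<le> \<epsilon> / 3" using R' by (simp add: field_simps)
  qed (simp add: T_def)
  define \<eta> where "\<eta> = min (\<epsilon> / L) (\<epsilon> / (3 * R'\<^sup>2 * s powr - \<alpha>))"
  have \<eta>: "0 < \<eta>" "\<eta> \<le> \<epsilon> / L" "R'\<^sup>2 * (\<eta> * s powr - \<alpha>) \<le> \<epsilon> / 3"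
  proof -
    show "0 < \<eta>" using \<epsilon> L R' s by (auto simp: \<eta>_def)
    have "\<eta> \<le> \<epsilon> / (3 * R'\<^sup>2 * s powr - \<alpha>)" by (simp add: \<eta>_def)
    then show "R'\<^sup>2 * (\<eta> * s powr - \<alpha>) \<le> \<epsilon> / 3" using R' s by (simp add: field_simps)
  qed (simp add: \<eta>_def)
  obtain t :: "nat \<Rightarrow> real" and n where t: "t 0 = s" "t n = T" "incseq t" "\<And>l. t (Suc l) - t l \<le> \<eta>"
    "\<And>l. l < n \<Longrightarrow> t l powr - \<alpha> - t (Suc l) powr - \<alpha> \<le> \<eta>"
    using powr_grid_exists[OF s(1) T(1) \<eta>(1)] by blast
  have tpos: "0 < t l" for l using t(1,3) s(1) by (auto simp: incseq_def intro: less_le_trans)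
  define Q where "Q = (\<Sum>l\<le>n. t l powr - \<alpha>)"
  have Q: "0 < Q" unfolding Q_def using tpos by (intro sum_pos) (auto simp: less_imp_neq[THEN not_sym])
  define \<delta> where "\<delta> = min 1 (\<epsilon> / (3 * Q))"
  have \<delta>: "0 < \<delta>" "\<delta> \<le> 1" "\<delta> * Q \<le> \<epsilon> / 3"
  proof -
    have "\<delta> \<le> \<epsilon> / (3 * Q)" by (simp add: \<delta>_def)
    then show "\<delta> * Q \<le> \<epsilon> / 3" using Q by (simp add: field_simps)
  qed (use \<epsilon> Q in \<open>auto simp: \<delta>_def\<close>)
  show thesis
  proof (rule that[OF \<delta>(1)])
    fix g h X Y
    assume gX: "is_simple_integral f m M g X" and hY: "is_simple_integral f m M h Y"
      and gR: "(\<integral>x. g x powr \<alpha> \<partial>m) \<le> R" and gh: "powr_dist m \<alpha> g h \<le> \<delta>"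
    show "P.prob {\<omega> \<in> space P. \<epsilon> < dist (X \<omega>) (Y \<omega>)} \<le> \<epsilon>"
    proof (rule common_atoms[OF gX hY])
      fix K :: "(nat \<times> nat) set" and C c d
      assume atoms: "implicit_frechet_atoms f \<alpha> \<kappa> m P M K C"
        and cd: "\<And>k. k \<in> K \<Longrightarrow> 0 \<le> c k" "\<And>k. k \<in> K \<Longrightarrow> 0 \<le> d k"
        and val: "\<And>k x. k \<in> K \<Longrightarrow> x \<in> C k \<Longrightarrow> g x = c k" "\<And>k x. k \<in> K \<Longrightarrow> x \<in> C k \<Longrightarrow> h x = d k"
          "\<And>x. x \<in> space m \<Longrightarrow> x \<notin> (\<Union>k\<in>K. C k) \<Longrightarrow> g x = 0" "\<And>x. x \<in> space m \<Longrightarrow> x \<notin> (\<Union>k\<in>K. C k) \<Longrightarrow> h x = 0"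
        and XY: "AE \<omega> in P. is_f_max f ((\<lambda>k. c k *\<^sub>R M (C k) \<omega>) ` K) (X \<omega>)"
          "AE \<omega> in P. is_f_max f ((\<lambda>k. d k *\<^sub>R M (C k) \<omega>) ` K) (Y \<omega>)"
      interpret atoms: implicit_frechet_atoms f \<alpha> \<kappa> m P M K C by (rule atoms)
      have "has_bochner_integral m (\<lambda>x. g x powr \<alpha>) (atoms.mass (\<lambda>k. c k powr \<alpha>))"
        using val by (intro atoms.has_bochner_integral_atoms) auto
      then have c: "atoms.mass (\<lambda>k. c k powr \<alpha>) \<le> R"
        using gR by (simp add: has_bochner_integral_integral_eq)
      have "has_bochner_integral m (\<lambda>x. \<bar>g x powr \<alpha> - h x powr \<alpha>\<bar>) (atoms.mass (\<lambda>k. \<bar>c k powr \<alpha> - d k powr \<alpha>\<bar>))"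
        using val by (intro atoms.has_bochner_integral_atoms) auto
      then have \<Delta>: "atoms.mass (\<lambda>k. \<bar>c k powr \<alpha> - d k powr \<alpha>\<bar>) \<le> \<delta>"
        using gh by (simp add: powr_dist_def has_bochner_integral_integral_eq)
      define u where "u = atoms.mass (\<lambda>k. max (c k) (d k) powr \<alpha>)"
      have "u \<le> atoms.mass (\<lambda>k. c k powr \<alpha> + \<bar>c k powr \<alpha> - d k powr \<alpha>\<bar>)"
        unfolding u_def by (intro atoms.mass_mono) (auto simp: max_def)
      also have "\<dots> = atoms.mass (\<lambda>k. c k powr \<alpha>) + atoms.mass (\<lambda>k. \<bar>c k powr \<alpha> - d k powr \<alpha>\<bar>)"
        by (simp add: atoms.mass_def sum.distrib distrib_right)
      finally have u: "0 \<le> u" "u \<le> R'"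
        using c \<Delta> \<delta>(2) R' unfolding u_def by (auto intro: atoms.mass_nonneg)
      have "P.prob {\<omega> \<in> space P. L * (\<epsilon> / L) < dist (X \<omega>) (Y \<omega>)} \<le>
          atoms.mass (\<lambda>k. \<bar>c k powr \<alpha> - d k powr \<alpha>\<bar>) * Q + (\<Sum>l<n. (u * (t l powr - \<alpha> - t (Suc l) powr - \<alpha>))\<^sup>2)
          + atoms.mass (\<lambda>k. c k powr \<alpha>) * t n powr - \<alpha>"
        unfolding Q_def u_def using L t s cd XY \<eta>(2)
        by (intro atoms.prob_dist_f_max_le) (auto intro: order_trans)
      also have "\<dots> \<le> \<epsilon> / 3 + \<epsilon> / 3 + \<epsilon> / 3"
      proof (intro add_mono)
        show "atoms.mass (\<lambda>k. \<bar>c k powr \<alpha> - d k powr \<alpha>\<bar>) * Q \<le> \<epsilon> / 3"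
          using mult_right_mono[OF \<Delta>, of Q] \<delta>(3) Q by linarith
        have "atoms.mass (\<lambda>k. c k powr \<alpha>) * t n powr - \<alpha> \<le> R' * T powr - \<alpha>"
          using c R' t(2) by (intro mult_mono) auto
        then show "atoms.mass (\<lambda>k. c k powr \<alpha>) * t n powr - \<alpha> \<le> \<epsilon> / 3" using T by linarith
        let ?w = "\<lambda>l. t l powr - \<alpha> - t (Suc l) powr - \<alpha>"
        have w: "0 \<le> ?w l" for l
          using tpos t(3) alpha_pos by (auto intro!: powr_mono2' simp: incseq_SucD)
        \<comment> \<open>One factor of each square is at most \<open>\<eta>\<close>; the other factors telescope.\<close>
        have "(\<Sum>l<n. (u * ?w l)\<^sup>2) \<le> (\<Sum>l<n. R'\<^sup>2 * (\<eta> * ?w l))"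
        proof (rule sum_mono)
          fix l assume "l \<in> {..<n}"
          then have ww: "?w l * ?w l \<le> \<eta> * ?w l" using t(5)[of l] w[of l] by (intro mult_right_mono) auto
          have uu: "u\<^sup>2 \<le> R'\<^sup>2" using u by (intro power_mono) auto
          show "(u * ?w l)\<^sup>2 \<le> R'\<^sup>2 * (\<eta> * ?w l)"
            unfolding power_mult_distrib power2_eq_square[of "?w l"] by (rule mult_mono[OF uu ww]) auto
        qed
        also have "\<dots> = R'\<^sup>2 * (\<eta> * (\<Sum>l<n. ?w l))" by (simp add: sum_distrib_left)
        also have "(\<Sum>l<n. ?w l) = s powr - \<alpha> - T powr - \<alpha>"
          using sum_lessThan_telescope'[of "\<lambda>l. t l powr - \<alpha>" n] t(1,2) by simp
        also have "R'\<^sup>2 * (\<eta> * (s powr - \<alpha> - T powr - \<alpha>)) \<le> R'\<^sup>2 * (\<eta> * s powr - \<alpha>)"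
          using \<eta> by (intro mult_left_mono) auto
        finally show "(\<Sum>l<n. (u * ?w l)\<^sup>2) \<le> \<epsilon> / 3" using \<eta>(3) by linarith
      qed
      finally show "P.prob {\<omega> \<in> space P. \<epsilon> < dist (X \<omega>) (Y \<omega>)} \<le> \<epsilon>" using L by simp
    qed
  qed
qed

end

section \<open>Existence and continuity of the integral\<close>

context implicit_frechet_sup_measure
begin

text \<open>Limits in probability of simple integrals whose integrands converge in \<open>powr_dist\<close>. Limits of this
kind are all that the uniform estimate and the joint law require in order to pass from simple
functions to general ones.\<close>

definition integral_version :: "('e \<Rightarrow> real) \<Rightarrow> ('w \<Rightarrow> real ^ 'd) \<Rightarrow> bool" where
  "integral_version g X \<longleftrightarrow> g \<in> Lp_plus m \<alpha> \<and> X \<in> borel_measurable P \<and>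
    (\<exists>h Y. (\<forall>n. is_simple_integral f m M (h n) (Y n)) \<and>
      (\<lambda>n. powr_dist m \<alpha> (h n) g) \<longlonglongrightarrow> 0 \<and> tendsto_in_prob P Y X)"

lemma integral_version_dist_uniform:
  assumes \<epsilon>: "0 < \<epsilon>"
  obtains \<delta> where "0 < \<delta>"
    "\<And>g h X Y. integral_version g X \<Longrightarrow> integral_version h Y \<Longrightarrow>
      (\<integral>x. g x powr \<alpha> \<partial>m) \<le> R \<Longrightarrow> powr_dist m \<alpha> g h \<le> \<delta> \<Longrightarrow>
      P.prob {\<omega> \<in> space P. \<epsilon> < dist (X \<omega>) (Y \<omega>)} \<le> \<epsilon>"
proof -
  have \<epsilon>3: "0 < \<epsilon> / 3" using \<epsilon> by simp
  obtain \<delta> where \<delta>: "0 < \<delta>" and close: "\<And>g h X Y. is_simple_integral f m M g X \<Longrightarrow> is_simple_integral f m M h Y \<Longrightarrow>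
      (\<integral>x. g x powr \<alpha> \<partial>m) \<le> R + 1 \<Longrightarrow> powr_dist m \<alpha> g h \<le> \<delta> \<Longrightarrow>
      P.prob {\<omega> \<in> space P. \<epsilon> / 3 < dist (X \<omega>) (Y \<omega>)} \<le> \<epsilon> / 3"
    using simple_integral_dist_uniform[OF \<epsilon>3, of "R + 1"] by blast
  show thesis
  proof (rule that[of "\<delta> / 3"])
    show "0 < \<delta> / 3" using \<delta> by simp
    fix g h X Y
    assume gX: "integral_version g X" and hY: "integral_version h Y"
      and R: "(\<integral>x. g x powr \<alpha> \<partial>m) \<le> R" and gh: "powr_dist m \<alpha> g h \<le> \<delta> / 3"
    have approx: "\<exists>g' X'. is_simple_integral f m M g' X' \<and> powr_dist m \<alpha> g' g \<le> min (\<delta> / 3) 1 \<and>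
        P.prob {\<omega> \<in> space P. \<epsilon> / 3 < dist (X' \<omega>) (X \<omega>)} \<le> \<epsilon> / 3" if gX: "integral_version g X" for g X
    proof -
      obtain gs Xs where s: "\<And>n. is_simple_integral f m M (gs n) (Xs n)"
        and d: "(\<lambda>n. powr_dist m \<alpha> (gs n) g) \<longlonglongrightarrow> 0" and p: "tendsto_in_prob P Xs X"
        using gX by (auto simp: integral_version_def)
      have "\<forall>\<^sub>F n in sequentially. powr_dist m \<alpha> (gs n) g < min (\<delta> / 3) 1"
        using \<delta> by (intro order_tendstoD(2)[OF d]) auto
      moreover have "(\<lambda>n. P.prob {\<omega> \<in> space P. \<epsilon> / 3 < dist (Xs n \<omega>) (X \<omega>)}) \<longlonglongrightarrow> 0"
        using p \<epsilon>3 unfolding tendsto_in_prob_def by blast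
      then have "\<forall>\<^sub>F n in sequentially. P.prob {\<omega> \<in> space P. \<epsilon> / 3 < dist (Xs n \<omega>) (X \<omega>)} < \<epsilon> / 3"
        by (rule order_tendstoD(2)[OF _ \<epsilon>3])
      ultimately have "\<forall>\<^sub>F n in sequentially. powr_dist m \<alpha> (gs n) g < min (\<delta> / 3) 1 \<and>
          P.prob {\<omega> \<in> space P. \<epsilon> / 3 < dist (Xs n \<omega>) (X \<omega>)} < \<epsilon> / 3" by (rule eventually_conj)
      then obtain n where "powr_dist m \<alpha> (gs n) g < min (\<delta> / 3) 1"
        "P.prob {\<omega> \<in> space P. \<epsilon> / 3 < dist (Xs n \<omega>) (X \<omega>)} < \<epsilon> / 3"
        unfolding eventually_sequentially by blast
      with s show ?thesis by (meson less_imp_le)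
    qed
    obtain g' X' where g': "is_simple_integral f m M g' X'" "powr_dist m \<alpha> g' g \<le> min (\<delta> / 3) 1"
      "P.prob {\<omega> \<in> space P. \<epsilon> / 3 < dist (X' \<omega>) (X \<omega>)} \<le> \<epsilon> / 3" using approx[OF gX] by blast
    obtain h' Y' where h': "is_simple_integral f m M h' Y'" "powr_dist m \<alpha> h' h \<le> min (\<delta> / 3) 1"
      "P.prob {\<omega> \<in> space P. \<epsilon> / 3 < dist (Y' \<omega>) (Y \<omega>)} \<le> \<epsilon> / 3" using approx[OF hY] by blast
    note Lp = simple_integral_Lp_plus[OF g'(1)] simple_integral_Lp_plus[OF h'(1)]
    have Lp': "g \<in> Lp_plus m \<alpha>" "h \<in> Lp_plus m \<alpha>" "X \<in> borel_measurable P" "Y \<in> borel_measurable P"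
      using gX hY by (auto simp: integral_version_def)
    note [measurable] = Lp'(3,4) simple_integral_measurable[OF g'(1)] simple_integral_measurable[OF h'(1)]
    have "powr_dist m \<alpha> g' h' \<le> powr_dist m \<alpha> g' g + (powr_dist m \<alpha> g h + powr_dist m \<alpha> h h')"
      using powr_dist_triangle[OF Lp(1) Lp'(1) Lp(2)] powr_dist_triangle[OF Lp'(1,2) Lp(2)] by linarith
    then have "powr_dist m \<alpha> g' h' \<le> \<delta>"
      using g'(2) h'(2) gh powr_dist_commute[of m \<alpha> h h'] by simp
    moreover have "(\<integral>x. g' x powr \<alpha> \<partial>m) \<le> R + 1"
      using integral_powr_le_add_powr_dist[OF Lp'(1) Lp(1)] R g'(2) powr_dist_commute[of m \<alpha> g g'] by simp
    ultimately have mid: "P.prob {\<omega> \<in> space P. \<epsilon> / 3 < dist (X' \<omega>) (Y' \<omega>)} \<le> \<epsilon> / 3"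
      using g'(1) h'(1) by (intro close)
    have "P.prob {\<omega> \<in> space P. \<epsilon> < dist (X \<omega>) (Y \<omega>)} \<le>
        P.prob {\<omega> \<in> space P. \<epsilon> / 3 < dist (X \<omega>) (X' \<omega>)} + P.prob {\<omega> \<in> space P. 2 * \<epsilon> / 3 < dist (X' \<omega>) (Y \<omega>)}"
      by (intro P.prob_dist_triangle) auto
    also have "P.prob {\<omega> \<in> space P. 2 * \<epsilon> / 3 < dist (X' \<omega>) (Y \<omega>)} \<le>
        P.prob {\<omega> \<in> space P. \<epsilon> / 3 < dist (X' \<omega>) (Y' \<omega>)} + P.prob {\<omega> \<in> space P. \<epsilon> / 3 < dist (Y' \<omega>) (Y \<omega>)}"
      by (intro P.prob_dist_triangle) auto
    finally show "P.prob {\<omega> \<in> space P. \<epsilon> < dist (X \<omega>) (Y \<omega>)} \<le> \<epsilon>"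
      using mid g'(3) h'(3) by (simp add: dist_commute)
  qed
qed

lemma simple_integral_imp_version:
  assumes "is_simple_integral f m M g X"
  shows "integral_version g X"
  unfolding integral_version_def
proof (intro conjI exI[of _ "\<lambda>_. g"] exI[of _ "\<lambda>_. X"])
  show "(\<lambda>n. powr_dist m \<alpha> g g) \<longlonglongrightarrow> 0" by (simp add: powr_dist_def)
  show "tendsto_in_prob P (\<lambda>_. X) X" by (simp add: tendsto_in_prob_def)
qed (use assms simple_integral_Lp_plus simple_integral_measurable in auto)

lemma integral_version_tendsto_in_prob:
  assumes g: "integral_version g X" and gs: "\<And>n. integral_version (gs n) (Xs n)"
    and lim: "(\<lambda>n. powr_dist m \<alpha> (gs n) g) \<longlonglongrightarrow> 0"
  shows "tendsto_in_prob P Xs X"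
proof (subst P.tendsto_in_prob_iff_Ky_Fan)
  show "Xs n \<in> borel_measurable P" "X \<in> borel_measurable P" for n
    using g gs[of n] by (auto simp: integral_version_def)
  show "\<forall>\<epsilon>>0. \<forall>\<^sub>F n in sequentially. P.prob {\<omega> \<in> space P. \<epsilon> < dist (Xs n \<omega>) (X \<omega>)} \<le> \<epsilon>"
  proof (intro allI impI)
    fix \<epsilon> :: real assume "0 < \<epsilon>"
    from integral_version_dist_uniform[OF this, of "\<integral>x. g x powr \<alpha> \<partial>m"]
    obtain \<delta> where \<delta>: "0 < \<delta>" and close: "\<And>g' h X Y. integral_version g' X \<Longrightarrow> integral_version h Y \<Longrightarrow>
        (\<integral>x. g' x powr \<alpha> \<partial>m) \<le> (\<integral>x. g x powr \<alpha> \<partial>m) \<Longrightarrow> powr_dist m \<alpha> g' h \<le> \<delta> \<Longrightarrow>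
        P.prob {\<omega> \<in> space P. \<epsilon> < dist (X \<omega>) (Y \<omega>)} \<le> \<epsilon>" by blast
    have "\<forall>\<^sub>F n in sequentially. powr_dist m \<alpha> (gs n) g < \<delta>"
      by (rule order_tendstoD(2)[OF lim \<delta>])
    then show "\<forall>\<^sub>F n in sequentially. P.prob {\<omega> \<in> space P. \<epsilon> < dist (Xs n \<omega>) (X \<omega>)} \<le> \<epsilon>"
    proof (rule eventually_mono)
      fix n assume "powr_dist m \<alpha> (gs n) g < \<delta>"
      then show "P.prob {\<omega> \<in> space P. \<epsilon> < dist (Xs n \<omega>) (X \<omega>)} \<le> \<epsilon>"
        using close[OF g gs[of n]] by (simp add: dist_commute powr_dist_commute)
    qed
  qed
qed

lemma integral_version_exists:
  assumes g: "g \<in> Lp_plus m \<alpha>"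
  obtains X h Y where "integral_version g X" "\<And>n. is_simple_integral f m M (h n) (Y n)"
    "\<And>x. x \<in> space m \<Longrightarrow> incseq (\<lambda>n. h n x) \<and> (\<lambda>n. h n x) \<longlonglongrightarrow> g x"
proof -
  obtain h where h: "\<And>n. \<exists>N a B. simple_repr m (h n) N a B"
    and mono: "\<And>x. x \<in> space m \<Longrightarrow> incseq (\<lambda>n. h n x) \<and> (\<lambda>n. h n x) \<longlonglongrightarrow> g x"
    using Lp_plus_simple_sequence[OF g alpha_pos] by blast
  have "\<forall>n. \<exists>Y. is_simple_integral f m M (h n) Y"
    using h unfolding is_simple_integral_def by blast
  then obtain Y where Y: "\<And>n. is_simple_integral f m M (h n) (Y n)" by metis
  note meas = simple_integral_measurable[OF Y]
  note hLp = simple_integral_Lp_plus[OF Y]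
  have lim: "(\<lambda>n. powr_dist m \<alpha> (h n) g) \<longlonglongrightarrow> 0"
    using powr_dist_monotone_approx[OF g alpha_pos hLp mono] by blast
  have Cauchy: "\<exists>N. \<forall>i\<ge>N. \<forall>j\<ge>N. P.prob {\<omega> \<in> space P. \<epsilon> < dist (Y i \<omega>) (Y j \<omega>)} \<le> \<epsilon>" if \<epsilon>: "0 < \<epsilon>" for \<epsilon>
  proof -
    obtain \<delta> where \<delta>: "0 < \<delta>" and close: "\<And>g' h X Y. is_simple_integral f m M g' X \<Longrightarrow> is_simple_integral f m M h Y \<Longrightarrow>
        (\<integral>x. g' x powr \<alpha> \<partial>m) \<le> (\<integral>x. g x powr \<alpha> \<partial>m) + 1 \<Longrightarrow> powr_dist m \<alpha> g' h \<le> \<delta> \<Longrightarrow>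
        P.prob {\<omega> \<in> space P. \<epsilon> < dist (X \<omega>) (Y \<omega>)} \<le> \<epsilon>"
      using simple_integral_dist_uniform[OF \<epsilon>, of "(\<integral>x. g x powr \<alpha> \<partial>m) + 1"] by blast
    have "\<forall>\<^sub>F n in sequentially. powr_dist m \<alpha> (h n) g < min (\<delta> / 2) 1"
      using \<delta> by (intro order_tendstoD(2)[OF lim]) auto
    then obtain N where N: "\<And>n. N \<le> n \<Longrightarrow> powr_dist m \<alpha> (h n) g < min (\<delta> / 2) 1"
      unfolding eventually_sequentially by blast
    have "P.prob {\<omega> \<in> space P. \<epsilon> < dist (Y i \<omega>) (Y j \<omega>)} \<le> \<epsilon>" if ij: "N \<le> i" "N \<le> j" for i j
    proof (rule close[OF Y Y])
      show "(\<integral>x. h i x powr \<alpha> \<partial>m) \<le> (\<integral>x. g x powr \<alpha> \<partial>m) + 1"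
        using integral_powr_le_add_powr_dist[OF g hLp[of i]] N[OF ij(1)] powr_dist_commute[of m \<alpha> g "h i"] by simp
      show "powr_dist m \<alpha> (h i) (h j) \<le> \<delta>"
        using powr_dist_triangle[OF hLp[of i] g hLp[of j]] N[OF ij(1)] N[OF ij(2)] powr_dist_commute[of m \<alpha> g "h j"] by simp
    qed
    then show ?thesis by blast
  qed
  obtain X where "X \<in> borel_measurable P" "tendsto_in_prob P Y X"
    by (rule P.Cauchy_in_prob_imp_tendsto_in_prob[OF meas Cauchy])
  then have "integral_version g X" unfolding integral_version_def using g Y lim by blast
  then show thesis using Y mono by (rule that)
qed

text \<open>The defining property of the integral is satisfiable: a limit along one increasing sequence exists by
completeness, and by the uniform estimate it is also the limit along every other one. The chosen
vector therefore has this property, and any increasing sequence of simple functions witnesses that it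
is a version.\<close>

lemma implicit_integral_version:
  assumes g: "g \<in> Lp_plus m \<alpha>"
  shows "integral_version g (implicit_integral f m P M g)"
proof -
  let ?spec = "\<lambda>X. X \<in> borel_measurable P \<and>
     (\<forall>h Y. (\<forall>n. is_simple_integral f m M (h n) (Y n)) \<longrightarrow>
        (\<forall>x\<in>space m. incseq (\<lambda>n. h n x) \<and> (\<lambda>n. h n x) \<longlonglongrightarrow> g x) \<longrightarrow> tendsto_in_prob P Y X)"
  have lim: "(\<lambda>n. powr_dist m \<alpha> (h n) g) \<longlonglongrightarrow> 0"
    if "\<And>n. is_simple_integral f m M (h n) (Y n)"
      "\<And>x. x \<in> space m \<Longrightarrow> incseq (\<lambda>n. h n x) \<and> (\<lambda>n. h n x) \<longlonglongrightarrow> g x" for h :: "nat \<Rightarrow> 'e \<Rightarrow> real" and Y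
    using powr_dist_monotone_approx[OF g alpha_pos simple_integral_Lp_plus[OF that(1)] that(2)] by blast
  obtain X h Y where X: "integral_version g X" and h: "\<And>n. is_simple_integral f m M (h n) (Y n)"
    "\<And>x. x \<in> space m \<Longrightarrow> incseq (\<lambda>n. h n x) \<and> (\<lambda>n. h n x) \<longlonglongrightarrow> g x"
    using integral_version_exists[OF g] by blast
  have "?spec X"
  proof (intro conjI allI impI)
    show "X \<in> borel_measurable P" using X by (simp add: integral_version_def)
    fix h Y assume "\<forall>n. is_simple_integral f m M (h n) (Y n)"
      "\<forall>x\<in>space m. incseq (\<lambda>n. h n x) \<and> (\<lambda>n. h n x) \<longlonglongrightarrow> g x"
    then show "tendsto_in_prob P Y X"
      using X simple_integral_imp_version lim[of h Y] by (intro integral_version_tendsto_in_prob[of g X h]) blast+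
  qed
  then have "?spec (implicit_integral f m P M g)"
    unfolding implicit_integral_def by (rule someI[where P = ?spec])
  then show ?thesis unfolding integral_version_def using g h lim[OF h] by blast
qed

end

section \<open>Joint laws and the converse\<close>

context implicit_frechet_sup_measure
begin

text \<open>On a common family the maximum of the two losses is the largest loss for the coefficients
\<open>max (c k) (d k)\<close>, so the event is one about independent variables.\<close>

lemma simple_integral_joint_law:
  assumes gX: "is_simple_integral f m M g X" and hY: "is_simple_integral f m M h Y" and x: "0 < x"
  shows "P.prob {\<omega> \<in> space P. max (f (X \<omega>)) (f (Y \<omega>)) \<le> x} =
    exp (- ((\<integral>z. max (g z powr \<alpha>) (h z powr \<alpha>) \<partial>m) * x powr - \<alpha>))"
proof (rule common_atoms[OF gX hY])
  fix K :: "(nat \<times> nat) set" and C c d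
  assume atoms: "implicit_frechet_atoms f \<alpha> \<kappa> m P M K C"
    and cd: "\<And>k. k \<in> K \<Longrightarrow> 0 \<le> c k" "\<And>k. k \<in> K \<Longrightarrow> 0 \<le> d k"
    and val: "\<And>k x. k \<in> K \<Longrightarrow> x \<in> C k \<Longrightarrow> g x = c k" "\<And>k x. k \<in> K \<Longrightarrow> x \<in> C k \<Longrightarrow> h x = d k"
      "\<And>x. x \<in> space m \<Longrightarrow> x \<notin> (\<Union>k\<in>K. C k) \<Longrightarrow> g x = 0" "\<And>x. x \<in> space m \<Longrightarrow> x \<notin> (\<Union>k\<in>K. C k) \<Longrightarrow> h x = 0"
    and XY: "AE \<omega> in P. is_f_max f ((\<lambda>k. c k *\<^sub>R M (C k) \<omega>) ` K) (X \<omega>)"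
      "AE \<omega> in P. is_f_max f ((\<lambda>k. d k *\<^sub>R M (C k) \<omega>) ` K) (Y \<omega>)"
  interpret atoms: implicit_frechet_atoms f \<alpha> \<kappa> m P M K C by (rule atoms)
  note [measurable] = simple_integral_measurable[OF gX] simple_integral_measurable[OF hY]
  let ?u = "\<lambda>k. max (c k) (d k)"
  have mx: "?u k * f v = max (c k * f v) (d k * f v)" for k v
    using nonneg[of v] by (auto simp: max_def mult_right_mono antisym)
  have "P.prob {\<omega> \<in> space P. max (f (X \<omega>)) (f (Y \<omega>)) \<le> x} =
      P.prob {\<omega> \<in> space P. \<forall>k\<in>K. ?u k * f (M (C k) \<omega>) \<le> x}"
  proof (rule P.finite_measure_eq_AE)
    show "AE \<omega> in P. \<omega> \<in> {\<omega> \<in> space P. max (f (X \<omega>)) (f (Y \<omega>)) \<le> x}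
        \<longleftrightarrow> \<omega> \<in> {\<omega> \<in> space P. \<forall>k\<in>K. ?u k * f (M (C k) \<omega>) \<le> x}"
      using XY
    proof eventually_elim
      case (elim \<omega>)
      show ?case using f_max_le_iff[OF elim(1) cd(1), of x] f_max_le_iff[OF elim(2) cd(2), of x]
        by (auto simp: mx)
    qed
    show "{\<omega> \<in> space P. \<forall>k\<in>K. ?u k * f (M (C k) \<omega>) \<le> x} \<in> P.events"
      using atoms.finite_K by measurable
  qed measurable
  also have "\<dots> = exp (- (atoms.mass (\<lambda>k. ?u k powr \<alpha>) * x powr - \<alpha>))"
  proof (rule atoms.prob_all_le[OF _ x])
    show "0 \<le> ?u k" if "k \<in> K" for k using cd(1)[OF that] by auto
  qed
  also have "atoms.mass (\<lambda>k. ?u k powr \<alpha>) = atoms.mass (\<lambda>k. max (c k powr \<alpha>) (d k powr \<alpha>))"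
    unfolding atoms.mass_def
  proof (intro sum.cong refl arg_cong2[where f = "(*)"])
    fix k assume "k \<in> K"
    then show "?u k powr \<alpha> = max (c k powr \<alpha>) (d k powr \<alpha>)"
      using powr_mono2[of \<alpha> "c k" "d k"] powr_mono2[of \<alpha> "d k" "c k"] cd[of k] alpha_pos by (auto simp: max_def)
  qed
  also have "has_bochner_integral m (\<lambda>z. max (g z powr \<alpha>) (h z powr \<alpha>)) (atoms.mass (\<lambda>k. max (c k powr \<alpha>) (d k powr \<alpha>)))"
    using val by (intro atoms.has_bochner_integral_atoms) auto
  then have "atoms.mass (\<lambda>k. max (c k powr \<alpha>) (d k powr \<alpha>)) = (\<integral>z. max (g z powr \<alpha>) (h z powr \<alpha>) \<partial>m)"
    by (simp add: has_bochner_integral_integral_eq)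
  finally show ?thesis .
qed

lemma integral_version_joint_law:
  assumes gX: "integral_version g X" and hY: "integral_version h Y" and x: "0 < x"
  shows "P.prob {\<omega> \<in> space P. max (f (X \<omega>)) (f (Y \<omega>)) \<le> x} =
    exp (- ((\<integral>z. max (g z powr \<alpha>) (h z powr \<alpha>) \<partial>m) * x powr - \<alpha>))"
proof -
  obtain gs Xs where gs: "\<And>n. is_simple_integral f m M (gs n) (Xs n)"
    "(\<lambda>n. powr_dist m \<alpha> (gs n) g) \<longlonglongrightarrow> 0" "tendsto_in_prob P Xs X"
    using gX by (auto simp: integral_version_def)
  obtain hs Ys where hs: "\<And>n. is_simple_integral f m M (hs n) (Ys n)"
    "(\<lambda>n. powr_dist m \<alpha> (hs n) h) \<longlonglongrightarrow> 0" "tendsto_in_prob P Ys Y"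
    using hY by (auto simp: integral_version_def)
  note [measurable] = simple_integral_measurable[OF gs(1)] simple_integral_measurable[OF hs(1)]
  have Lp: "g \<in> Lp_plus m \<alpha>" "h \<in> Lp_plus m \<alpha>" and meas[measurable]: "X \<in> borel_measurable P" "Y \<in> borel_measurable P"
    using gX hY by (auto simp: integral_version_def)
  note gLp = simple_integral_Lp_plus[OF gs(1)] and hLp = simple_integral_Lp_plus[OF hs(1)]
  let ?c = "\<lambda>g h. \<integral>z. max (g z powr \<alpha>) (h z powr \<alpha>) \<partial>m"
  have c: "(\<lambda>n. ?c (gs n) (hs n)) \<longlonglongrightarrow> ?c g h"
  proof (rule Lim_transform[OF tendsto_const])
    have "\<bar>?c (gs n) (hs n) - ?c g h\<bar> \<le> powr_dist m \<alpha> (gs n) g + powr_dist m \<alpha> (hs n) h" for n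
    proof -
      note int = Lp_plus_integrable[OF Lp(1)] Lp_plus_integrable[OF Lp(2)] Lp_plus_integrable[OF gLp[of n]]
        Lp_plus_integrable[OF hLp[of n]] Lp_plus_integrable_abs_diff[OF gLp[of n] Lp(1)] Lp_plus_integrable_abs_diff[OF hLp[of n] Lp(2)]
      have "\<bar>?c (gs n) (hs n) - ?c g h\<bar> =
          \<bar>\<integral>z. max (gs n z powr \<alpha>) (hs n z powr \<alpha>) - max (g z powr \<alpha>) (h z powr \<alpha>) \<partial>m\<bar>"
        using int by (subst Bochner_Integration.integral_diff) auto
      also have "\<dots> \<le> (\<integral>z. \<bar>max (gs n z powr \<alpha>) (hs n z powr \<alpha>) - max (g z powr \<alpha>) (h z powr \<alpha>)\<bar> \<partial>m)"
        by (rule integral_abs_bound)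
      also have "\<dots> \<le> (\<integral>z. \<bar>gs n z powr \<alpha> - g z powr \<alpha>\<bar> + \<bar>hs n z powr \<alpha> - h z powr \<alpha>\<bar> \<partial>m)"
        using int by (intro integral_mono Bochner_Integration.integrable_add integrable_abs
            Bochner_Integration.integrable_diff integrable_max) (auto simp: max_def)
      also have "\<dots> = powr_dist m \<alpha> (gs n) g + powr_dist m \<alpha> (hs n) h"
        unfolding powr_dist_def using int by simp
      finally show ?thesis .
    qed
    then show "(\<lambda>n. ?c (gs n) (hs n) - ?c g h) \<longlonglongrightarrow> 0"
      by (intro Lim_null_comparison[OF _ tendsto_add_zero[OF gs(2) hs(2)]] always_eventually) simp
  qed
  have "tendsto_in_prob P (\<lambda>n \<omega>. max (f (Xs n \<omega>)) (f (Ys n \<omega>))) (\<lambda>\<omega>. max (f (X \<omega>)) (f (Y \<omega>)))"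
  proof (rule P.tendsto_in_prob_max)
    show "tendsto_in_prob P (\<lambda>n \<omega>. f (Xs n \<omega>)) (\<lambda>\<omega>. f (X \<omega>))"
      by (rule P.tendsto_in_prob_continuous_map[OF simple_integral_measurable[OF gs(1)] meas(1) gs(3) continuous])
    show "tendsto_in_prob P (\<lambda>n \<omega>. f (Ys n \<omega>)) (\<lambda>\<omega>. f (Y \<omega>))"
      by (rule P.tendsto_in_prob_continuous_map[OF simple_integral_measurable[OF hs(1)] meas(2) hs(3) continuous])
  qed measurable
  moreover have "(\<lambda>n. P.prob {\<omega> \<in> space P. max (f (Xs n \<omega>)) (f (Ys n \<omega>)) \<le> y})
      \<longlonglongrightarrow> exp (- (?c g h * y powr - \<alpha>))" if "0 < y" for y
    unfolding simple_integral_joint_law[OF gs(1) hs(1) that] by (intro tendsto_intros c)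
  moreover have "isCont (\<lambda>y. exp (- (?c g h * y powr - \<alpha>))) x"
    using x by (intro continuous_intros) auto
  ultimately show ?thesis
    by (intro P.cdf_of_limit_in_prob[where F = "\<lambda>y. exp (- (?c g h * y powr - \<alpha>))"] x) auto
qed

text \<open>The level \<open>1\<close> is used since there the exponents in the laws are the integrals themselves; the law of
the limit is continuous at \<open>1\<close>, and the logarithm recovers the integrals from the probabilities.\<close>

lemma tendsto_in_prob_imp_powr_dist_tendsto:
  assumes g: "integral_version g X" and gs: "\<And>n. integral_version (gs n) (Xs n)"
    and lim: "tendsto_in_prob P Xs X"
  shows "(\<lambda>n. powr_dist m \<alpha> (gs n) g) \<longlonglongrightarrow> 0"
proof -
  have Lp: "g \<in> Lp_plus m \<alpha>" "\<And>n. gs n \<in> Lp_plus m \<alpha>"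
    and meas[measurable]: "X \<in> borel_measurable P" "\<And>n. Xs n \<in> borel_measurable P"
    using g gs by (auto simp: integral_version_def)
  let ?N = "\<lambda>g. \<integral>z. g z powr \<alpha> \<partial>m" and ?c = "\<lambda>n. \<integral>z. max (gs n z powr \<alpha>) (g z powr \<alpha>) \<partial>m"
  have law: "P.prob {\<omega> \<in> space P. f (X \<omega>) \<le> x} = exp (- (?N g * x powr - \<alpha>))" if "integral_version g X" "0 < x" for g X x
    using integral_version_joint_law[OF that(1,1,2)] by simp
  have flim: "tendsto_in_prob P (\<lambda>n \<omega>. f (Xs n \<omega>)) (\<lambda>\<omega>. f (X \<omega>))"
    by (rule P.tendsto_in_prob_continuous_map[OF meas(2,1) lim continuous])
  have cont_exp: "isCont (\<lambda>y. exp (- (?N g * y powr - \<alpha>))) 1"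
    by (intro continuous_intros) auto
  have "\<forall>\<^sub>F y in nhds (1::real). exp (- (?N g * y powr - \<alpha>)) = P.prob {\<omega> \<in> space P. f (X \<omega>) \<le> y}"
    by (rule eventually_mono[OF eventually_nhds_in_open[of "{0<..}"]]) (auto simp: law[OF g])
  from iffD1[OF isCont_cong[OF this] cont_exp] have cont: "isCont (\<lambda>y. P.prob {\<omega> \<in> space P. f (X \<omega>) \<le> y}) 1"
    .
  note conv = P.tendsto_in_prob_imp_prob_le_tendsto[OF _ _ flim cont]
  have "(\<lambda>n. P.prob {\<omega> \<in> space P. f (Xs n \<omega>) \<le> 1}) \<longlonglongrightarrow> P.prob {\<omega> \<in> space P. f (X \<omega>) \<le> 1}"
    using conv[of "space P"] by (simp add: Int_absorb2)
  then have "(\<lambda>n. exp (- ?N (gs n))) \<longlonglongrightarrow> exp (- ?N g)" using law[OF gs] law[OF g] by simp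
  from tendsto_ln[OF this] have 1: "(\<lambda>n. ?N (gs n)) \<longlonglongrightarrow> ?N g" by (simp add: tendsto_minus_cancel_left)
  have "(\<lambda>n. P.prob ({\<omega> \<in> space P. f (Xs n \<omega>) \<le> 1} \<inter> {\<omega> \<in> space P. f (X \<omega>) \<le> 1}))
      \<longlonglongrightarrow> P.prob ({\<omega> \<in> space P. f (X \<omega>) \<le> 1} \<inter> {\<omega> \<in> space P. f (X \<omega>) \<le> 1})"
    by (rule conv) auto
  moreover have "{\<omega> \<in> space P. f (Xs n \<omega>) \<le> 1} \<inter> {\<omega> \<in> space P. f (X \<omega>) \<le> 1} =
      {\<omega> \<in> space P. max (f (Xs n \<omega>)) (f (X \<omega>)) \<le> 1}" for n by auto
  ultimately have "(\<lambda>n. exp (- ?c n)) \<longlonglongrightarrow> exp (- ?N g)"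
    using integral_version_joint_law[OF gs g, of 1] law[OF g, of 1] by simp
  from tendsto_ln[OF this] have 2: "(\<lambda>n. ?c n) \<longlonglongrightarrow> ?N g" by (simp add: tendsto_minus_cancel_left)
  have "(\<lambda>n. 2 * ?c n - ?N (gs n) - ?N g) \<longlonglongrightarrow> 2 * ?N g - ?N g - ?N g"
    by (intro tendsto_intros 1 2)
  moreover have "2 * ?c n - ?N (gs n) - ?N g = powr_dist m \<alpha> (gs n) g" for n
    using integral_max_powr[OF Lp(2)[of n] Lp(1)] by simp
  ultimately show ?thesis by simp
qed

end

section \<open>The equivalence\<close>

theorem theorem4p3:
  fixes f :: "real ^ 'd \<Rightarrow> real"
    and \<alpha> :: real
    and \<kappa> :: "(real ^ 'd) measure"
    and m :: "'e measure"
    and P :: "'w measure"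
    and M :: "'e set \<Rightarrow> 'w \<Rightarrow> real ^ 'd"
    and g :: "'e \<Rightarrow> real"
    and gs :: "nat \<Rightarrow> 'e \<Rightarrow> real"
  assumes "implicit_frechet_sup_measure f \<alpha> \<kappa> m P M"
    and "g \<in> Lp_plus m \<alpha>"
    and "\<And>n. gs n \<in> Lp_plus m \<alpha>"
  shows "(tendsto_in_prob P (\<lambda>n. implicit_integral f m P M (gs n)) (implicit_integral f m P M g)
            \<longleftrightarrow> (\<lambda>n. \<integral>\<^sup>+x. ennreal \<bar>gs n x powr \<alpha> - g x powr \<alpha>\<bar> \<partial>m) \<longlonglongrightarrow> 0)
       \<and> ((\<lambda>n. \<integral>\<^sup>+x. ennreal \<bar>gs n x powr \<alpha> - g x powr \<alpha>\<bar> \<partial>m) \<longlonglongrightarrow> 0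
            \<longleftrightarrow> (\<lambda>n. \<integral>\<^sup>+x. ennreal (\<bar>gs n x - g x\<bar> powr \<alpha>) \<partial>m) \<longlonglongrightarrow> 0)"
proof -
  interpret implicit_frechet_sup_measure f \<alpha> \<kappa> m P M by (rule assms(1))
  note versions = implicit_integral_version[OF assms(2)] implicit_integral_version[OF assms(3)]
  have "(\<integral>\<^sup>+x. ennreal \<bar>gs n x powr \<alpha> - g x powr \<alpha>\<bar> \<partial>m) = ennreal (powr_dist m \<alpha> (gs n) g)" for n
    unfolding powr_dist_def using Lp_plus_integrable_abs_diff[OF assms(3,2)] by (intro nn_integral_eq_integral) auto
  then have "(\<lambda>n. \<integral>\<^sup>+x. ennreal \<bar>gs n x powr \<alpha> - g x powr \<alpha>\<bar> \<partial>m) \<longlonglongrightarrow> 0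
      \<longleftrightarrow> (\<lambda>n. powr_dist m \<alpha> (gs n) g) \<longlonglongrightarrow> 0"
    by (simp add: ennreal_tendsto_0_iff powr_dist_def)
  moreover have "tendsto_in_prob P (\<lambda>n. implicit_integral f m P M (gs n)) (implicit_integral f m P M g)
      \<longleftrightarrow> (\<lambda>n. powr_dist m \<alpha> (gs n) g) \<longlonglongrightarrow> 0"
    using integral_version_tendsto_in_prob[OF versions] tendsto_in_prob_imp_powr_dist_tendsto[OF versions] by (rule iffI[rotated])
  ultimately show ?thesis using powr_L1_iff_Lp[OF alpha_pos assms(2,3)] by simp
qed

end
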